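(* The class of $Z$-free chordal bipartite graphs is factorial.
   Context: All graphs are finite and simple. $G$ is $H$-free if it has no induced subgraph isomorphic to $H$. $Z$ is the 7-vertex graph obtained from a cycle $C_4$ on vertices $c_1,c_2,c_3,c_4$ by attaching a path of length $3$ at $c_1$ (edges: $c_1c_2,c_2c_3,c_3c_4,c_4c_1,c_1p,pq,qr$, where $p,q,r$ are new vertices). A bipartite graph is chordal bipartite if it has no induced cycles of length at least $6$. A hereditary class (closed under taking induced subgraphs) is factorial if the number of labelled graphs in it on vertex set $\{1,\dots,n\}$ is $2^{\Theta(n\log n)}$. *)

theory Defs
  imports
    "HOL-Library.Landau_Symbols"
    "Graph_Theory.Pair_Digraph"
    "Graph_Theory.Digraph_Isomorphism"
begin

text \<open>
  A finite simple graph is a \<^locale>\<open>pair_graph\<close>: a finite vertex set together with a symmetric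
  irreflexive set of arcs, so that an edge $uv$ is the pair of arcs $(u,v)$, $(v,u)$.
\<close>

definition graph_of_edges :: "'a set \<Rightarrow> 'a rel \<Rightarrow> 'a pair_pre_digraph" where
  "graph_of_edges V E = \<lparr> pverts = V, parcs = symcl E \<rparr>"

definition H_free :: "'b pair_pre_digraph \<Rightarrow> 'a pair_pre_digraph \<Rightarrow> bool" where
  "H_free H G \<longleftrightarrow>
     \<not> (\<exists>K. induced_subgraph (with_proj K) (with_proj G) \<and> digraph_iso (with_proj K) (with_proj H))"

text \<open>The vertices $c_1, c_2, c_3, c_4, p, q, r$ are numbered $1, \ldots, 7$ in this order.\<close>

definition Z_graph :: "nat pair_pre_digraph" where
  "Z_graph = graph_of_edges {1..7} {(1,2), (2,3), (3,4), (4,1), (1,5), (5,6), (6,7)}"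

text \<open>A simple graph only for $k \geq 3$.\<close>

definition cycle_graph :: "nat \<Rightarrow> nat pair_pre_digraph" where
  "cycle_graph k = graph_of_edges {0..<k} {(i, Suc i mod k) | i. i < k}"

definition bipartite :: "'a pair_pre_digraph \<Rightarrow> bool" where
  "bipartite G \<longleftrightarrow>
     (\<exists>A B. A \<union> B = pverts G \<and> A \<inter> B = {} \<and> parcs G \<subseteq> (A \<times> B) \<union> (B \<times> A))"

definition chordal_bipartite :: "'a pair_pre_digraph \<Rightarrow> bool" where
  "chordal_bipartite G \<longleftrightarrow> pair_graph G \<and> bipartite G \<and> (\<forall>k\<ge>6. H_free (cycle_graph k) G)"

text \<open>
  Graph classes are isomorphism-closed sets of finite simple graphs. Vertices are natural numbers,
  which loses nothing, since every finite graph is isomorphic to such a graph.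
\<close>

definition graph_class :: "nat pair_pre_digraph set \<Rightarrow> bool" where
  "graph_class X \<longleftrightarrow>
     (\<forall>G\<in>X. pair_graph G) \<and>
     (\<forall>G\<in>X. \<forall>H. digraph_iso (with_proj G) (with_proj H) \<longrightarrow> H \<in> X)"

definition hereditary :: "nat pair_pre_digraph set \<Rightarrow> bool" where
  "hereditary X \<longleftrightarrow>
     graph_class X \<and>
     (\<forall>G\<in>X. \<forall>H. induced_subgraph (with_proj H) (with_proj G) \<longrightarrow> H \<in> X)"

definition labelled_graphs :: "nat pair_pre_digraph set \<Rightarrow> nat \<Rightarrow> nat pair_pre_digraph set" where
  "labelled_graphs X n = {G \<in> X. pverts G = {1..n}}"

definition factorial_class :: "nat pair_pre_digraph set \<Rightarrow> bool" where
  "factorial_class X \<longleftrightarrow>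
     hereditary X \<and>
     (\<exists>f :: nat \<Rightarrow> real. f \<in> \<Theta>(\<lambda>n. real n * log 2 (real n)) \<and>
        (\<forall>\<^sub>F n in at_top. real (card (labelled_graphs X n)) = 2 powr f n))"

lemma pair_graph_graph_of_edges:
  assumes "finite V" "E \<subseteq> V \<times> V" "\<And>v. (v, v) \<notin> E"
  shows "pair_graph (graph_of_edges V E)"
proof -
  have "finite E"
    using assms by (meson finite_SigmaI finite_subset)
  then show ?thesis
    using assms
    by unfold_locales (auto simp: graph_of_edges_def symcl_def symmetric_def intro!: symI)
qed

lemma pair_graph_Z_graph: "pair_graph Z_graph"
  unfolding Z_graph_def by (rule pair_graph_graph_of_edges) auto

lemma pair_graph_cycle_graph:
  assumes "k \<ge> 3"
  shows "pair_graph (cycle_graph k)"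
  unfolding cycle_graph_def
  by (rule pair_graph_graph_of_edges) (use assms in \<open>auto simp: mod_Suc intro!: gr0I split: if_splits\<close>)

end

theory Submission
  imports Defs
begin

text \<open>
  Every nonempty graph in the class has a vertex \<open>v\<close> whose neighbourhood differs in at most four
  elements from the empty set or from \<open>N(a) \<inter> N(b)\<close>, for some vertices \<open>a, b\<close> other than \<open>v\<close>.
  Hence \<open>v\<close> is determined by \<open>G - v\<close> and six labels, and removing such vertices one by one shows that
  there are at most \<open>(n + 1)\<^sup>7\<^sup>n\<close> labelled graphs. Star forests give the lower bound.

  To find \<open>v\<close>, regard one side of the bipartition as columns and the other as rows, that is, as sets
  of columns. Suppose that no vertex \<open>v\<close> exists, and take a smallest cell \<open>C\<close> (defined below)
  with at least two columns. Some two rows cross inside \<open>C\<close>; a smallest intersection of crossing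
  rows is a single column, because it would be a smaller cell otherwise. Walking along
  rows that consecutively cross in single columns must end, since there are no long induced cycles,
  and the end of the walk yields a smaller cell, contradicting the choice of \<open>C\<close>.
\<close>

section \<open>Totally balanced hypergraphs without Z\<close>

lemma ex_two_distinct: "2 \<le> card X \<Longrightarrow> \<exists>x \<in> X. \<exists>y \<in> X. x \<noteq> y"
  by (metis One_nat_def card_le_Suc0_iff_eq card.infinite not_less_eq_eq numeral_2_eq_2 zero_le)

text \<open>Elements of \<open>A\<close> are rows, elements of \<open>B\<close> columns.
  \<open>no_cycle\<close> forbids induced cycles of length \<open>2 * m\<close>; in
  \<open>no_Z\<close> the columns \<open>x\<close>, \<open>y\<close>, \<open>p\<close>,
  \<open>u\<close> stand for the vertices c2, c4, p, r of Z.\<close>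

locale tame_hypergraph =
  fixes A :: "'a set" and B :: "'b set" and N :: "'a \<Rightarrow> 'b set"
  assumes finite_A: "finite A" and finite_B: "finite B"
    and N_subset: "\<And>r. r \<in> A \<Longrightarrow> N r \<subseteq> B"
    and no_cycle: "\<And>m r c. \<lbrakk>3 \<le> m; \<And>j. j < m \<Longrightarrow> r j \<in> A;
      \<And>i j. \<lbrakk>i < m; j < m\<rbrakk> \<Longrightarrow> c i \<in> N (r j) \<longleftrightarrow> j = i \<or> j = Suc i mod m\<rbrakk> \<Longrightarrow> False"
    and no_Z: "\<And>c1 c3 q x y p u. \<lbrakk>c1 \<in> A; c3 \<in> A; q \<in> A; x \<noteq> y; x \<in> N c1 \<inter> N c3 - N q; y \<in> N c1 \<inter> N c3 - N q;
      p \<in> N c1 \<inter> N q - N c3; u \<in> N q - N c1 - N c3\<rbrakk> \<Longrightarrow> False"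
begin

text \<open>The bound 2 serves two purposes: sets that contain \<open>T\<close> and exceed it by at
  most 2 columns differ in at most 4, and a row through \<open>T\<close> that is not short has at
  least 3 further columns.\<close>

definition short :: "'b set \<Rightarrow> 'a set" where
  "short T = {P \<in> A. T \<subseteq> N P \<and> card (N P - T) \<le> 2}"

text \<open>Seen from a cell \<open>C\<close>, apart from the rows that are at most two columns larger than \<open>T\<close>,
  the rest of the hypergraph is trivial: a row meeting \<open>C\<close> contains \<open>T\<close>, and it either contains
  all of \<open>C\<close> or has no columns outside \<open>T \<union> C\<close>.\<close>

definition cell :: "'b set \<Rightarrow> 'b set \<Rightarrow> bool" where
  "cell T C \<longleftrightarrow> C \<subseteq> B \<and> T \<inter> C = {} \<and>
     (\<forall>P \<in> A - short T. N P \<inter> C \<noteq> {} \<longrightarrow> T \<subseteq> N P \<and> (C \<subseteq> N P \<or> N P \<subseteq> T \<union> C))"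

definition inner :: "'b set \<Rightarrow> 'b set \<Rightarrow> 'a set" where
  "inner T C = {P \<in> A - short T. N P \<inter> C \<noteq> {} \<and> \<not> C \<subseteq> N P}"

definition crosses :: "'b set \<Rightarrow> 'a \<Rightarrow> 'a \<Rightarrow> bool" where
  "crosses C P Q \<longleftrightarrow> N P \<inter> N Q \<inter> C \<noteq> {} \<and> \<not> N P \<inter> C \<subseteq> N Q \<and> \<not> N Q \<inter> C \<subseteq> N P"

text \<open>The case \<open>a = b\<close> is allowed, so \<open>S\<close> may be a single
  row.\<close>

definition row_describable :: "'a \<Rightarrow> bool" where
  "row_describable P \<longleftrightarrow> (\<exists>S. (S = {} \<or> (\<exists>a \<in> A - {P}. \<exists>b \<in> A - {P}. S = N a \<inter> N b)) \<and>
     card ((N P - S) \<union> (S - N P)) \<le> 4)"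

text \<open>One comparison column \<open>d\<close> is enough here; in the graph it becomes the
  neighbourhood of \<open>d\<close> intersected with itself.\<close>

definition column_describable :: "'b \<Rightarrow> bool" where
  "column_describable c \<longleftrightarrow> card {r \<in> A. c \<in> N r} \<le> 4 \<or> (\<exists>d \<in> B - {c}.
     card {r \<in> A. c \<in> N r \<longleftrightarrow> d \<notin> N r} \<le> 4)"

section \<open>Induced cycles among the rows\<close>

lemma finite_N: "r \<in> A \<Longrightarrow> finite (N r)"
  using N_subset finite_B finite_subset by blast

lemma no_6_cycle:
  assumes "R \<in> A" "P \<in> A" "Q \<in> A"
    and "x \<in> N R \<inter> N P - N Q" "y \<in> N P \<inter> N Q - N R" "z \<in> N Q \<inter> N R - N P"
  shows False
proof (rule no_cycle[of 3 "\<lambda>i. [R, P, Q] ! i" "\<lambda>i. [x, y, z] ! i"])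
  fix j :: nat assume "j < 3"
  then have "j = 0 \<or> j = 1 \<or> j = 2" by auto
  then show "[R, P, Q] ! j \<in> A" using assms by auto
next
  fix i j :: nat assume "i < 3" "j < 3"
  then have "i = 0 \<or> i = 1 \<or> i = 2" "j = 0 \<or> j = 1 \<or> j = 2" by auto
  then show "[x, y, z] ! i \<in> N ([R, P, Q] ! j) \<longleftrightarrow> j = i \<or> j = Suc i mod 3"
    using assms by (elim disjE) auto
qed simp

text \<open>An endless walk in which row \<open>i + 2\<close> leaves through a new column of row \<open>i + 1\<close> returns
  to an earlier row; the shortest such return is an induced cycle.\<close>

lemma no_endless_walk:
  assumes W: "\<And>i. W i \<in> A"
    and meet: "\<And>i. N (W i) \<inter> N (W (Suc i)) \<inter> C \<noteq> {}"
    and disj: "\<And>i. N (W i) \<inter> N (W (Suc (Suc i))) \<inter> C = {}"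
  shows False
proof -
  define bad where "bad d \<longleftrightarrow> 2 \<le> d \<and> (\<exists>i. N (W i) \<inter> N (W (i + d)) \<inter> C \<noteq> {})" for d
  have "\<exists>d. bad d"
  proof -
    have "finite (range W)"
      using W finite_A by (meson finite_subset image_subsetI)
    then have "\<not> inj W" using finite_imageD infinite_UNIV_nat by blast
    then obtain i j where ij: "i < j" "W i = W j"
      by (metis injI linorder_neqE_nat)
    \<comment> \<open>Row \<open>Suc j\<close> meets row \<open>j\<close>, which is the same as row
      \<open>i\<close>.\<close>
    have "N (W i) \<inter> N (W (i + (Suc j - i))) \<inter> C \<noteq> {}"
      using meet[of j] ij by simp
    moreover have "2 \<le> Suc j - i" using ij by simp
    ultimately show ?thesis unfolding bad_def by blast
  qed
  define d where "d = (LEAST d. bad d)"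
  have "bad d" unfolding d_def using \<open>\<exists>d. bad d\<close> by (rule LeastI_ex)
  then obtain i x where d2: "2 \<le> d" and x: "x \<in> N (W i)" "x \<in> N (W (i + d))" "x \<in> C"
    unfolding bad_def by blast
  have "d \<noteq> 2" using x disj[of i] by auto
  with d2 have d3: "3 \<le> d" by simp
  \<comment> \<open>By minimality of \<open>d\<close>, rows at a distance from 2 to
    \<open>d - 1\<close> are disjoint within \<open>C\<close>.\<close>
  have far: "N (W k) \<inter> N (W l) \<inter> C = {}" if "k + 2 \<le> l" "l < k + d" for k l
  proof (rule ccontr)
    assume "N (W k) \<inter> N (W l) \<inter> C \<noteq> {}"
    then have "bad (l - k)" unfolding bad_def using that by (auto intro!: exI[of _ k])
    then have "d \<le> l - k" unfolding d_def by (rule Least_le)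
    then show False using that by simp
  qed
  define s where "s i = (SOME y. y \<in> N (W i) \<inter> N (W (Suc i)) \<inter> C)" for i
  have s: "s i \<in> N (W i) \<inter> N (W (Suc i)) \<inter> C" for i
    unfolding s_def some_in_eq by (rule meet)
  show False
  \<comment> \<open>The cycle runs through the \<open>d + 1\<close> rows
    \<open>W i, ..., W (i + d)\<close>. The columns \<open>s\<close> link consecutive rows, and
    \<open>x\<close> links the last row back to the first.\<close>
  proof (rule no_cycle[of "Suc d" "\<lambda>j. W (i + j)" "\<lambda>j. if j = d then x else s (i + j)"])
    fix a b assume ab: "a < Suc d" "b < Suc d"
    show "(if a = d then x else s (i + a)) \<in> N (W (i + b)) \<longleftrightarrow> b = a \<or> b = Suc a mod Suc d"
    proof (cases "a = d")
      case True
      have "x \<notin> N (W (i + b))" if "b \<noteq> 0" "b \<noteq> d"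
      proof
        assume xb: "x \<in> N (W (i + b))"
        show False
        proof (cases "b = 1")
          case True
          with xb x far[of "i + 1" "i + d"] d3 show False by auto
        next
          case False
          with that ab xb x far[of i "i + b"] show False by auto
        qed
      qed
      with True x ab show ?thesis by auto
    next
      case False
      with ab have "a < d" by simp
      then have "Suc a mod Suc d = Suc a" by simp
      moreover have "s (i + a) \<notin> N (W (i + b))" if ba: "b \<noteq> a" "b \<noteq> Suc a"
      proof
        assume sb: "s (i + a) \<in> N (W (i + b))"
        have sa: "s (i + a) \<in> N (W (i + a))" "s (i + a) \<in> N (W (i + Suc a))" "s (i + a) \<in> C"
          using s[of "i + a"] by auto
        \<comment> \<open>A third row through \<open>s (i + a)\<close> meets both rows that this
          column links. In each case one of the two is at a distance from 2 to \<open>d - 1\<close>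
          from it, contradicting \<open>far\<close>.\<close>
        consider "b < a" | "a + 2 \<le> b" "b < a + d" | "a = 0" "b = d"
          using ba ab \<open>a < d\<close> by linarith
        then show False
        proof cases
          case 1
          show False
          proof (cases "Suc a < b + d")
            case True
            then show False using far[of "i + b" "i + Suc a"] 1 sa sb by auto
          next
            case False
            then show False using far[of "i + b" "i + a"] 1 sa sb d3 \<open>a < d\<close> by auto
          qed
        next
          case 2
          with far[of "i + a" "i + b"] sa sb show False by auto
        next
          case 3
          with far[of "i + 1" "i + d"] sa sb d3 show False by auto
        qed
      qed
      ultimately show ?thesis using False s[of "i + a"] by auto
    qed
  qed (use d3 W in auto)
qed

section \<open>Short rows and inner rows of a cell\<close>

lemma finite_short: "finite (short T)"
  using finite_A by (simp add: short_def)

text \<open>An inner row does not contain \<open>C\<close>, so the cell condition confines it to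
  \<open>T \<union> C\<close>. Since it is not short, at least three of its columns lie in
  \<open>C\<close>.\<close>

lemma innerD:
  assumes "cell T C" "P \<in> inner T C"
  shows "P \<in> A" "P \<notin> short T" "T \<subseteq> N P" "N P \<subseteq> T \<union> C" "N P \<inter> C \<noteq> {}" "\<not> C \<subseteq> N P"
    "N P \<inter> C = N P - T" "3 \<le> card (N P \<inter> C)"
proof -
  show *: "P \<in> A" "P \<notin> short T" "T \<subseteq> N P" "N P \<subseteq> T \<union> C" "N P \<inter> C \<noteq> {}" "\<not> C \<subseteq> N P"
    using assms by (auto simp: cell_def inner_def)
  show **: "N P \<inter> C = N P - T"
    using * assms(1) by (auto simp: cell_def)
  show "3 \<le> card (N P \<inter> C)"
    using * unfolding ** by (auto simp: short_def)
qed

text \<open>Both \<open>N P\<close> and \<open>N a \<inter> N b\<close> are \<open>T\<close> plus at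
  most two columns, so they differ in at most four.\<close>

lemma row_describableI:
  assumes "P \<in> A" "T \<subseteq> N P" "card (N P - T) \<le> 2"
    and "a \<in> A - {P}" "b \<in> A - {P}" "T \<subseteq> N a \<inter> N b" "card (N a \<inter> N b - T) \<le> 2"
  shows "row_describable P"
proof -
  let ?S = "N a \<inter> N b"
  have fin: "finite (N P - T)" "finite (?S - T)"
    using assms finite_N by auto
  have "card ((N P - ?S) \<union> (?S - N P)) \<le> card ((N P - T) \<union> (?S - T))"
    using fin assms by (intro card_mono) auto
  also have "\<dots> \<le> card (N P - T) + card (?S - T)" by (rule card_Un_le)
  also have "\<dots> \<le> 4" using assms by simp
  finally show ?thesis unfolding row_describable_def using assms by blast
qed

text \<open>Among three short rows, each is described by the intersection of the other two, which
  again contains \<open>T\<close> and at most two more columns.\<close>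

lemma card_short_le:
  assumes "\<And>P. P \<in> A \<Longrightarrow> \<not> row_describable P"
  shows "card (short T) \<le> 2"
proof (rule ccontr)
  assume "\<not> ?thesis"
  then have "3 \<le> card (short T)" by simp
  then obtain F where F: "F \<subseteq> short T" "card F = 3"
    by (meson obtain_subset_with_card_n)
  then obtain P a b where "F = {P, a, b}" "a \<noteq> P" "b \<noteq> P"
    by (auto simp: card_3_iff)
  with F have *: "P \<in> short T" "a \<in> short T" "b \<in> short T" "a \<noteq> P" "b \<noteq> P" by auto
  have "card (N a \<inter> N b - T) \<le> card (N a - T)"
    using * finite_N by (intro card_mono) (auto simp: short_def)
  then have "row_describable P"
    using * by (intro row_describableI[of P T a b]) (auto simp: short_def)
  with assms * show False by (auto simp: short_def)
qed

text \<open>Without inner rows, every row that is not short contains all of \<open>C\<close> or none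
  of it. Two columns of \<open>C\<close> are then separated by short rows only, of which there are
  at most two.\<close>

lemma inner_nonempty:
  assumes "\<And>P. P \<in> A \<Longrightarrow> \<not> row_describable P" "\<And>c. c \<in> B \<Longrightarrow> \<not> column_describable c"
    and "cell T C" "2 \<le> card C"
  shows "inner T C \<noteq> {}"
proof
  assume none: "inner T C = {}"
  obtain c d where cd: "c \<in> C" "d \<in> C" "c \<noteq> d"
    using ex_two_distinct[OF \<open>2 \<le> card C\<close>] by blast
  have "{r \<in> A. c \<in> N r \<longleftrightarrow> d \<notin> N r} \<subseteq> short T"
    using none cd \<open>cell T C\<close> unfolding inner_def by blast
  then have "card {r \<in> A. c \<in> N r \<longleftrightarrow> d \<notin> N r} \<le> 2"
    using card_short_le[OF assms(1)] finite_short card_mono le_trans by meson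
  then have "card {r \<in> A. c \<in> N r \<longleftrightarrow> d \<notin> N r} \<le> 4" by simp
  moreover have "c \<in> B" "d \<in> B - {c}" using cd \<open>cell T C\<close> by (auto simp: cell_def)
  ultimately show False using assms(2) unfolding column_describable_def by blast
qed

section \<open>Crossing rows in a smallest cell\<close>

lemma cell_finite: "cell T C \<Longrightarrow> finite C"
  using finite_B finite_subset by (auto simp: cell_def)

text \<open>If no inner row crosses \<open>P\<close>, then \<open>N P \<inter> C\<close> is a cell
  for the same \<open>T\<close>, and it is strictly smaller than \<open>C\<close>.\<close>

lemma inner_crossed:
  assumes "cell T C" and min: "\<And>T' C'. \<lbrakk>cell T' C'; 2 \<le> card C'\<rbrakk> \<Longrightarrow> card C \<le> card C'"
    and P: "P \<in> inner T C"
  shows "\<exists>Q \<in> inner T C. crosses C P Q"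
proof (rule ccontr)
  assume none: "\<not> ?thesis"
  note PD = innerD[OF \<open>cell T C\<close> P]
  have "cell T (N P \<inter> C)"
    unfolding cell_def
  proof (intro conjI ballI impI)
    fix W assume W: "W \<in> A - short T" "N W \<inter> (N P \<inter> C) \<noteq> {}"
    then show "T \<subseteq> N W" using \<open>cell T C\<close> unfolding cell_def by blast
    show "N P \<inter> C \<subseteq> N W \<or> N W \<subseteq> T \<union> N P \<inter> C"
    proof (cases "C \<subseteq> N W")
      case False
      then have "W \<in> inner T C" using W by (auto simp: inner_def)
      then show ?thesis
        using none W innerD(4)[OF \<open>cell T C\<close> \<open>W \<in> inner T C\<close>] unfolding crosses_def by blast
    qed auto
  qed (use \<open>cell T C\<close> in \<open>auto simp: cell_def\<close>)
  then have "card C \<le> card (N P \<inter> C)" using min PD(8) by simp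
  moreover have "card (N P \<inter> C) < card C"
    using PD cell_finite[OF \<open>cell T C\<close>] by (intro psubset_card_mono) auto
  ultimately show False by simp
qed

text \<open>Otherwise the smallest intersection of two crossing rows would itself be a smaller cell.\<close>

lemma minimal_intersection_singleton:
  assumes "cell T C" and min: "\<And>T' C'. \<lbrakk>cell T' C'; 2 \<le> card C'\<rbrakk> \<Longrightarrow> card C \<le> card C'"
    and R: "R \<in> inner T C" and Q: "Q \<in> inner T C" and cr: "crosses C R Q"
    and least: "\<And>R' Q'. \<lbrakk>R' \<in> inner T C; Q' \<in> inner T C; crosses C R' Q'\<rbrakk> \<Longrightarrow>
      card (N R \<inter> N Q \<inter> C) \<le> card (N R' \<inter> N Q' \<inter> C)"
  shows "card (N R \<inter> N Q \<inter> C) = 1"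
proof (rule ccontr)
  define T1 where "T1 = N R \<inter> N Q \<inter> C"
  assume "card (N R \<inter> N Q \<inter> C) \<noteq> 1"
  moreover have fC: "finite C" using assms(1) by (rule cell_finite)
  ultimately have two: "2 \<le> card T1"
    using cr card_gt_0_iff[of T1] unfolding T1_def crosses_def by force
  note RD = innerD[OF assms(1) R] and QD = innerD[OF assms(1) Q]
  have "cell T T1"
    unfolding cell_def
  proof (intro conjI ballI impI)
    fix W assume W: "W \<in> A - short T" "N W \<inter> T1 \<noteq> {}"
    then show "T \<subseteq> N W" using assms(1) unfolding cell_def T1_def by blast
    show "T1 \<subseteq> N W \<or> N W \<subseteq> T \<union> T1"
    proof (rule ccontr)
      assume neg: "\<not> ?thesis"
      then have WI: "W \<in> inner T C" using W by (auto simp: inner_def T1_def)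
      note WD = innerD[OF assms(1) WI]
      \<comment> \<open>If \<open>s\<close> lies in \<open>W\<close> and \<open>X\<close> but not in
        \<open>Y\<close>, then \<open>W\<close> crosses \<open>Y\<close>. Their intersection is at
        least as large as \<open>T1\<close> but does not contain it, so it has a column
        \<open>q\<close> outside \<open>X\<close>. With some \<open>t\<close> in \<open>T1\<close>
        outside \<open>W\<close>, the rows \<open>X\<close>, \<open>W\<close>, \<open>Y\<close> form
        an induced 6-cycle through \<open>s\<close>, \<open>q\<close>, \<open>t\<close>.\<close>
      have out: "N W \<inter> C \<inter> N X \<subseteq> N Y"
        if XY: "X \<in> inner T C" "Y \<in> inner T C" "T1 = N X \<inter> N Y \<inter> C" for X Y
      proof
        fix s assume s: "s \<in> N W \<inter> C \<inter> N X"
        show "s \<in> N Y"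
        proof (rule ccontr)
          assume "s \<notin> N Y"
          have "crosses C W Y"
            using W neg s \<open>s \<notin> N Y\<close> XY(3) by (auto simp: crosses_def)
          then have le: "card T1 \<le> card (N W \<inter> N Y \<inter> C)"
            using least WI XY(2) unfolding T1_def by blast
          have "\<not> N W \<inter> N Y \<inter> C \<subseteq> N X"
          proof
            assume "N W \<inter> N Y \<inter> C \<subseteq> N X"
            then have "N W \<inter> N Y \<inter> C \<subset> T1" using neg XY(3) by auto
            then show False
              using le fC XY(3) psubset_card_mono[of T1 "N W \<inter> N Y \<inter> C"] by auto
          qed
          then obtain q where q: "q \<in> N W" "q \<in> N Y" "q \<notin> N X" by auto
          obtain t where t: "t \<in> T1" "t \<notin> N W" using neg by auto
          show False
            using no_6_cycle[of X W Y s q t] s q t XY \<open>s \<notin> N Y\<close> WD(1)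
              innerD(1)[OF assms(1)] by auto
        qed
      qed
      \<comment> \<open>Now \<open>W\<close> meets \<open>R\<close> only inside \<open>T1\<close>
        and misses part of \<open>T1\<close>, yet it crosses \<open>R\<close>; this contradicts the
        choice of the smallest intersection.\<close>
      have 1: "N W \<inter> C \<inter> N R \<subseteq> N Q" using out[OF R Q] T1_def by blast
      have "crosses C W R"
        using W neg 1 WD(4) by (auto simp: crosses_def T1_def)
      then have "card T1 \<le> card (N W \<inter> N R \<inter> C)"
        using least WI R unfolding T1_def by blast
      moreover have "N W \<inter> N R \<inter> C \<subset> T1" using 1 neg unfolding T1_def by auto
      ultimately show False
        using fC psubset_card_mono[of T1 "N W \<inter> N R \<inter> C"] by (auto simp: T1_def)
    qed
  qed (use assms(1) in \<open>auto simp: cell_def T1_def\<close>)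
  then have "card C \<le> card T1" using min two by simp
  moreover have "T1 \<subset> C" using RD unfolding T1_def by auto
  ultimately show False using psubset_card_mono[OF fC, of T1] by simp
qed

text \<open>One step of the walk from \<open>Q\<close> over \<open>R\<close> to \<open>W\<close>. A
  common column of \<open>W\<close> and \<open>Q\<close> would give a 6-cycle, and a second common
  column of \<open>W\<close> and \<open>R\<close> would give Z, with \<open>s\<close> and that
  column in its 4-cycle and the tail leading through \<open>t\<close> to \<open>Q\<close>. Having
  three columns in \<open>C\<close>, the row \<open>W\<close> then leaves \<open>R\<close>.\<close>

lemma touching_row:
  assumes "cell T C" and I: "R \<in> inner T C" "Q \<in> inner T C" "W \<in> inner T C"
    and "crosses C R Q" and t: "N R \<inter> N Q \<inter> C = {t}"
    and "t \<notin> N W" "s \<in> N W \<inter> N R \<inter> C"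
  shows "N W \<inter> N Q \<inter> C = {}" "N R \<inter> N W \<inter> C = {s}" "crosses C W R"
proof -
  note RD = innerD[OF assms(1) I(1)] and QD = innerD[OF assms(1) I(2)] and WD = innerD[OF assms(1) I(3)]
  have sW: "s \<in> N W" "s \<in> N R" "s \<in> C" and "s \<noteq> t" using assms(7,8) by auto
  have tin: "t \<in> N R" "t \<in> N Q" "t \<in> C" and only_t: "\<And>y. \<lbrakk>y \<in> N R; y \<in> N Q; y \<in> C\<rbrakk> \<Longrightarrow> y = t"
    using t by (metis Int_iff singletonI singletonD)+
  have "s \<notin> N Q" using only_t sW \<open>s \<noteq> t\<close> by metis
  show disj: "N W \<inter> N Q \<inter> C = {}"
  proof (rule ccontr)
    assume "\<not> ?thesis"
    then obtain q where q: "q \<in> N W" "q \<in> N Q" "q \<in> C" by auto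
    then have "q \<notin> N R" using only_t \<open>t \<notin> N W\<close> by metis
    then show False
      using no_6_cycle[of R W Q s q t] q sW tin \<open>s \<notin> N Q\<close> \<open>t \<notin> N W\<close> RD(1) QD(1) WD(1) by simp
  qed
  obtain u where u: "u \<in> N Q" "u \<in> C" "u \<notin> N R"
    using \<open>crosses C R Q\<close> unfolding crosses_def by blast
  have yQ: "y \<notin> N Q" if "y \<in> N W" "y \<in> C" for y using disj that by auto
  have only_s: "y = s" if "y \<in> N R" "y \<in> N W" "y \<in> C" for y
  proof (rule ccontr)
    assume "y \<noteq> s"
    then show False
      using no_Z[of R W Q s y t u] that yQ u sW tin \<open>t \<notin> N W\<close> RD(1) QD(1) WD(1) by auto
  qed
  show "N R \<inter> N W \<inter> C = {s}"
  proof (rule set_eqI)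
    show "y \<in> N R \<inter> N W \<inter> C \<longleftrightarrow> y \<in> {s}" for y using only_s[of y] sW by auto
  qed
  have "\<not> N W \<inter> C \<subseteq> N R"
  proof
    assume "N W \<inter> C \<subseteq> N R"
    have "N W \<inter> C \<subseteq> {s}"
    proof
      show "y \<in> {s}" if "y \<in> N W \<inter> C" for y
        using only_s[of y] that \<open>N W \<inter> C \<subseteq> N R\<close> by auto
    qed
    then have "card (N W \<inter> C) \<le> 1" using card_mono[of "{s}"] by fastforce
    then show False using WD(8) by simp
  qed
  then show "crosses C W R" using sW tin \<open>t \<notin> N W\<close> unfolding crosses_def by auto
qed

text \<open>If every such pair had a row \<open>W\<close> touching \<open>R\<close> but missing
  \<open>t\<close>, then \<open>touching_row\<close> could be applied forever, against
  \<open>no_endless_walk\<close>.\<close>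

lemma end_of_walk:
  assumes "cell T C" and I: "R0 \<in> inner T C" "Q0 \<in> inner T C"
    and cr: "crosses C R0 Q0" "card (N R0 \<inter> N Q0 \<inter> C) = 1"
  obtains R Q t where "R \<in> inner T C" "Q \<in> inner T C" "crosses C R Q" "N R \<inter> N Q \<inter> C = {t}"
    "\<And>W. \<lbrakk>W \<in> inner T C; N W \<inter> (N R \<inter> C - {t}) \<noteq> {}\<rbrakk> \<Longrightarrow> t \<in> N W"
proof (rule ccontr)
  assume "\<not> thesis"
  note neg = that
  \<comment> \<open>A state of the walk is the pair of the previous row \<open>Q\<close> and the
    current row \<open>R\<close>; the next state is \<open>(R, W)\<close>.\<close>
  define ok where "ok x \<longleftrightarrow> (case x of (Q, R) \<Rightarrow> R \<in> inner T C \<and> Q \<in> inner T C \<and>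
    crosses C R Q \<and> (\<exists>t. N R \<inter> N Q \<inter> C = {t}))" for x :: "'a \<times> 'a"
  have "\<exists>f. \<forall>n. ok (f n) \<and> (snd (f n) = fst (f (Suc n)) \<and>
      N (fst (f n)) \<inter> N (snd (f (Suc n))) \<inter> C = {})"
  proof (rule dependent_nat_choice)
    show "\<exists>x. ok x"
      using I cr by (intro exI[of _ "(Q0, R0)"]) (auto simp: ok_def card_1_singleton_iff)
  next
    fix x n assume "ok x"
    obtain Q R where x: "x = (Q, R)" by fastforce
    with \<open>ok x\<close> obtain t where QR: "R \<in> inner T C" "Q \<in> inner T C" "crosses C R Q"
      "N R \<inter> N Q \<inter> C = {t}" by (auto simp: ok_def)
    with neg \<open>\<not> thesis\<close> obtain W s where W: "W \<in> inner T C" "s \<in> N W \<inter> N R \<inter> C" "t \<notin> N W"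
      by blast
    note touching_row[OF assms(1) QR(1,2) W(1) QR(3,4) W(3,2)]
    then show "\<exists>y. ok y \<and> (snd x = fst y \<and> N (fst x) \<inter> N (snd y) \<inter> C = {})"
      using W QR x by (intro exI[of _ "(R, W)"]) (auto simp: ok_def)
  qed
  then obtain f where f: "\<And>n. ok (f n)" "\<And>n. snd (f n) = fst (f (Suc n))"
    "\<And>n. N (fst (f n)) \<inter> N (snd (f (Suc n))) \<inter> C = {}" by blast
  have f': "fst (f n) \<in> inner T C" "crosses C (fst (f (Suc n))) (fst (f n))" for n
    using f(1)[of n] f(2)[of n] by (auto simp: ok_def split: prod.splits)
  show False
  proof (rule no_endless_walk[of "\<lambda>n. fst (f n)" C])
    show "fst (f i) \<in> A" for i using f'(1) innerD(1)[OF assms(1)] by blast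
    show "N (fst (f i)) \<inter> N (fst (f (Suc i))) \<inter> C \<noteq> {}" for i
      using f'(2)[of i] by (auto simp: crosses_def)
    show "N (fst (f i)) \<inter> N (fst (f (Suc (Suc i)))) \<inter> C = {}" for i
      using f(3)[of i] f(2)[of "Suc i"] by simp
  qed
qed

text \<open>Let \<open>D\<close> be the set of columns all of whose inner rows contain \<open>t\<close>, and \<open>K\<close> the part of \<open>D\<close>
  connected to \<open>R\<close> by rows within \<open>D \<union> {t}\<close>. By \<open>Z\<close>-freeness, a row meeting \<open>K\<close> and leaving
  \<open>D \<union> {t}\<close> contains all of \<open>K\<close>, so \<open>K\<close> is a smaller cell for \<open>insert t T\<close>.\<close>

lemma singleton_intersection_impossible:
  assumes nr: "\<And>P. P \<in> A \<Longrightarrow> \<not> row_describable P"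
    and "cell T C" and min: "\<And>T' C'. \<lbrakk>cell T' C'; 2 \<le> card C'\<rbrakk> \<Longrightarrow> card C \<le> card C'"
    and I: "R \<in> inner T C" "Q \<in> inner T C" and cr: "crosses C R Q"
    and t: "N R \<inter> N Q \<inter> C = {t}"
    and dom: "\<And>W. \<lbrakk>W \<in> inner T C; N W \<inter> (N R \<inter> C - {t}) \<noteq> {}\<rbrakk> \<Longrightarrow> t \<in> N W"
  shows False
proof -
  note RD = innerD[OF assms(2) I(1)] and QD = innerD[OF assms(2) I(2)]
  have fC: "finite C" using assms(2) by (rule cell_finite)
  \<comment> \<open>A short row would be described by \<open>R\<close> and \<open>Q\<close>, whose
    intersection is \<open>T\<close> plus at most the column \<open>t\<close>.\<close>
  have no_short: "short T = {}"
  proof (rule ccontr)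
    assume "short T \<noteq> {}"
    then obtain P where P: "P \<in> short T" by auto
    have "N R \<inter> N Q - T \<subseteq> {t}" using t RD(4) by auto
    then have "card (N R \<inter> N Q - T) \<le> 1" using card_mono[of "{t}"] by fastforce
    then have "row_describable P"
      using P RD QD by (intro row_describableI[of P T R Q]) (auto simp: short_def)
    then show False using nr P by (auto simp: short_def)
  qed
  define D where "D = {v \<in> C - {t}. \<forall>W \<in> inner T C. v \<in> N W \<longrightarrow> t \<in> N W}"
  define small where "small P \<longleftrightarrow> P \<in> inner T C \<and> N P \<inter> D \<noteq> {} \<and> N P \<inter> C - {t} \<subseteq> D" for P
  define closed where "closed X \<longleftrightarrow> X \<subseteq> D \<and> (\<forall>P. small P \<and> N P \<inter> X \<noteq> {} \<longrightarrow> N P \<inter> C - {t} \<subseteq> X)" for X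
  \<comment> \<open>The least closed set containing the columns of \<open>R\<close> in
    \<open>C\<close> other than \<open>t\<close>; the factor \<open>D\<close> makes
    \<open>K \<subseteq> D\<close> immediate.\<close>
  define K where "K = D \<inter> \<Inter> {X. closed X \<and> N R \<inter> C - {t} \<subseteq> X}"
  have KD: "K \<subseteq> D" by (auto simp: K_def)
  have RDsub: "N R \<inter> C - {t} \<subseteq> D" unfolding D_def using dom by blast
  then have RK: "N R \<inter> C - {t} \<subseteq> K" by (auto simp: K_def)
  have K_min: "K \<subseteq> X" if "closed X" "N R \<inter> C - {t} \<subseteq> X" for X
    using that by (auto simp: K_def)
  have K_closed: "N P \<inter> C - {t} \<subseteq> K" if "small P" "N P \<inter> K \<noteq> {}" for P
  proof
    fix y assume y: "y \<in> N P \<inter> C - {t}"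
    have "y \<in> D" using y \<open>small P\<close> by (auto simp: small_def)
    moreover have "y \<in> X" if X: "closed X" "N R \<inter> C - {t} \<subseteq> X" for X
    proof -
      have "N P \<inter> X \<noteq> {}" using K_min[OF X] \<open>N P \<inter> K \<noteq> {}\<close> by auto
      then have "N P \<inter> C - {t} \<subseteq> X" using X(1) \<open>small P\<close> unfolding closed_def by simp
      then show ?thesis using y by auto
    qed
    ultimately show "y \<in> K" by (auto simp: K_def)
  qed
  \<comment> \<open>The row \<open>P\<close> has a column \<open>v\<close> outside \<open>D\<close>,
    so some inner row \<open>W\<close> contains \<open>v\<close> and misses \<open>t\<close>. Such a
    \<open>W\<close> is disjoint from \<open>P2\<close> within \<open>C\<close>, and two copies of Z
    arise if \<open>P2\<close> has a column \<open>e\<close> outside \<open>P\<close>.\<close>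
  have big: "N P2 \<inter> C \<subseteq> N P"
    if P: "P \<in> inner T C" "\<not> N P \<inter> C - {t} \<subseteq> D" and P2: "small P2" and d: "d \<in> N P \<inter> N P2 \<inter> D" for P P2 d
  proof (rule ccontr)
    assume "\<not> ?thesis"
    then obtain e where e: "e \<in> N P2" "e \<in> C" "e \<notin> N P" by blast
    have tP: "t \<in> N P" "t \<in> N P2" using P P2 d unfolding D_def small_def by auto
    obtain v where v: "v \<in> N P" "v \<in> C" "v \<noteq> t" "v \<notin> D" using P(2) by auto
    then obtain W where W: "W \<in> inner T C" "v \<in> N W" "t \<notin> N W" unfolding D_def by auto
    note WD = innerD[OF assms(2) W(1)] and PD = innerD[OF assms(2) P(1)]
    have P2I: "P2 \<in> inner T C" and P2s: "N P2 \<inter> C - {t} \<subseteq> D" using P2 by (auto simp: small_def)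
    note P2D = innerD[OF assms(2) P2I]
    have disj: "N W \<inter> N P2 \<inter> C = {}" using P2s W unfolding D_def by blast
    have dC: "d \<in> C" "d \<noteq> t" "d \<notin> N W" using d W unfolding D_def by auto
    \<comment> \<open>Otherwise Z arises with \<open>d\<close>, \<open>t\<close> in the 4-cycle of
      \<open>P\<close> and \<open>P2\<close>, and the tail from \<open>P\<close> through
      \<open>v\<close> to \<open>W\<close> and on to \<open>u\<close>.\<close>
    have WP: "N W \<inter> C \<subseteq> N P"
    proof (rule ccontr)
      assume "\<not> ?thesis"
      then obtain u where u: "u \<in> N W" "u \<in> C" "u \<notin> N P" by blast
      show False
        using no_Z[of P P2 W d t v u] u disj v W d dC tP WD(1) PD(1) P2D(1) by blast
    qed
    \<comment> \<open>Now two columns of \<open>W\<close> form a 4-cycle with \<open>P\<close> and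
      \<open>W\<close>, and the tail leads from \<open>P\<close> through \<open>d\<close> to
      \<open>P2\<close> and on to \<open>e\<close>.\<close>
    obtain x y where xy: "x \<in> N W" "y \<in> N W" "x \<in> C" "y \<in> C" "x \<noteq> y"
      using ex_two_distinct[of "N W \<inter> C"] WD(8) by auto
    have "x \<in> N P" "y \<in> N P" using WP xy by auto
    moreover have "x \<notin> N P2" "y \<notin> N P2" "e \<notin> N W" using disj xy e by auto
    ultimately show False
      using no_Z[of P W P2 x y d e] xy d dC e WD(1) PD(1) P2D(1) by simp
  qed
  have big_full: "K \<subseteq> N P"
    if P: "P \<in> inner T C" "\<not> N P \<inter> C - {t} \<subseteq> D" "N P \<inter> K \<noteq> {}" for P
  \<comment> \<open>By \<open>big\<close>, a small row meeting \<open>P\<close> in \<open>D\<close>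
    has all its columns of \<open>C\<close> in \<open>P\<close>. So both
    \<open>N P \<inter> D\<close> and \<open>D - N P\<close> are closed, and \<open>K\<close> lies
    in whichever contains the columns of \<open>R\<close>. As \<open>P\<close> meets
    \<open>K\<close>, it is the first.\<close>
  proof (cases "N R \<inter> C - {t} \<subseteq> N P")
    case True
    have "closed (N P \<inter> D)"
      unfolding closed_def
    proof (intro conjI allI impI)
      fix P2 assume P2: "small P2 \<and> N P2 \<inter> (N P \<inter> D) \<noteq> {}"
      then have "N P2 \<inter> C \<subseteq> N P" using big[OF P(1,2)] by blast
      then show "N P2 \<inter> C - {t} \<subseteq> N P \<inter> D" using P2 by (auto simp: small_def)
    qed auto
    then show ?thesis using K_min[of "N P \<inter> D"] True RDsub by auto
  next
    case False
    have cl: "closed (D - N P)"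
      unfolding closed_def
    proof (intro conjI allI impI)
      fix P2 assume P2: "small P2 \<and> N P2 \<inter> (D - N P) \<noteq> {}"
      have "N P2 \<inter> N P \<inter> D = {}"
      proof (rule ccontr)
        assume "\<not> ?thesis"
        then have "N P2 \<inter> C \<subseteq> N P" using big[OF P(1,2)] P2 by blast
        then show False using P2 unfolding D_def by blast
      qed
      then show "N P2 \<inter> C - {t} \<subseteq> D - N P" using P2 by (auto simp: small_def)
    qed auto
    obtain r where "r \<in> N R" "r \<in> C" "r \<noteq> t" "r \<notin> N P" using False by auto
    then have "small R" using RDsub I unfolding small_def by auto
    have "N R \<inter> C - {t} \<subseteq> D - N P"
      using cl \<open>small R\<close> \<open>r \<in> N R\<close> \<open>r \<in> C\<close> \<open>r \<noteq> t\<close> \<open>r \<notin> N P\<close> RDsub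
      unfolding closed_def by blast
    then have "K \<subseteq> D - N P" using K_min cl by simp
    then show ?thesis using P(3) by auto
  qed
  have KC: "K \<subseteq> C - {t}" using KD by (auto simp: D_def)
  have "cell (insert t T) K"
    unfolding cell_def
  proof (intro conjI ballI impI)
    show "K \<subseteq> B" "insert t T \<inter> K = {}" using KC assms(2) by (auto simp: cell_def)
  next
    fix P assume P: "P \<in> A - short (insert t T)" "N P \<inter> K \<noteq> {}"
    \<comment> \<open>As \<open>short T\<close> is empty, the cell condition of \<open>C\<close>
      applies to every row, even though enlarging \<open>T\<close> to \<open>insert t T\<close>
      changes which rows are short.\<close>
    then have P': "P \<in> A - short T" "N P \<inter> C \<noteq> {}" using no_short KC by auto
    then have TP: "T \<subseteq> N P" using assms(2) unfolding cell_def by blast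
    have inn: "P \<in> inner T C" if "\<not> C \<subseteq> N P" using that P' by (simp add: inner_def)
    have tC: "t \<in> C" using t by auto
    show "insert t T \<subseteq> N P"
      using TP tC inn P(2) KD unfolding D_def by blast
    show "K \<subseteq> N P \<or> N P \<subseteq> insert t T \<union> K"
    proof (cases "C \<subseteq> N P")
      case False
      note PI = inn[OF False]
      show ?thesis
      proof (cases "N P \<inter> C - {t} \<subseteq> D")
        case True
        then have "small P" using PI P(2) KD by (auto simp: small_def)
        then show ?thesis using K_closed P(2) innerD(4)[OF assms(2) PI] by blast
      qed (use big_full PI P(2) in auto)
    qed (use KC in auto)
  qed
  \<comment> \<open>\<open>R\<close> has at least three columns in \<open>C\<close>, and
    \<open>K\<close> contains all of them except \<open>t\<close>.\<close>
  moreover have "2 \<le> card K"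
  proof -
    have "card (N R \<inter> C) - 1 \<le> card (N R \<inter> C - {t})"
      by (simp add: card_Diff_singleton_if)
    also have "\<dots> \<le> card K" using RK KC fC by (meson card_mono finite_Diff finite_subset)
    finally show ?thesis using RD(8) by simp
  qed
  ultimately have "card C \<le> card K" using min by blast
  moreover have "card K < card C"
    using KC fC t by (intro psubset_card_mono) auto
  ultimately show False by simp
qed

lemma ex_describable:
  assumes "A \<noteq> {} \<or> B \<noteq> {}"
  shows "(\<exists>P \<in> A. row_describable P) \<or> (\<exists>c \<in> B. column_describable c)"
proof (rule ccontr)
  assume neg: "\<not> ?thesis"
  then have nr: "\<And>P. P \<in> A \<Longrightarrow> \<not> row_describable P"
    and nc: "\<And>c. c \<in> B \<Longrightarrow> \<not> column_describable c" by auto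
  have "A \<noteq> {}"
  proof
    assume "A = {}"
    then show False using assms nc unfolding column_describable_def by auto
  qed
  then obtain P where P: "P \<in> A" by auto
  have "2 \<le> card B"
  proof (rule ccontr)
    assume "\<not> 2 \<le> card B"
    then have "card (N P) \<le> 4"
      using card_mono[OF finite_B N_subset[OF P]] by simp
    then have "row_describable P" unfolding row_describable_def by (intro exI[of _ "{}"]) simp
    then show False using nr P by simp
  qed
  \<comment> \<open>The whole column set is a cell, so a smallest cell with at least two columns
    exists.\<close>
  have "cell {} B" unfolding cell_def using N_subset by auto
  then have "\<exists>n. \<exists>T C. cell T C \<and> 2 \<le> card C \<and> card C = n" using \<open>2 \<le> card B\<close> by blast
  from LeastI_ex[OF this] obtain T C where C: "cell T C" "2 \<le> card C"
    and n: "card C = (LEAST n. \<exists>T C. cell T C \<and> 2 \<le> card C \<and> card C = n)" by blast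
  have min: "card C \<le> card C'" if "cell T' C'" "2 \<le> card C'" for T' C'
    unfolding n using that by (intro Least_le) blast
  obtain P0 where P0: "P0 \<in> inner T C" using inner_nonempty[OF nr nc C] by blast
  have "\<exists>Q \<in> inner T C. crosses C P0 Q" using C(1) min P0 by (rule inner_crossed)
  then obtain Q0 where Q0: "Q0 \<in> inner T C" "crosses C P0 Q0" by blast
  \<comment> \<open>Pairs of crossing inner rows; \<open>x\<close> is chosen among them with
    smallest intersection in \<open>C\<close>.\<close>
  define cp where "cp x \<longleftrightarrow> fst x \<in> inner T C \<and> snd x \<in> inner T C \<and> crosses C (fst x) (snd x)" for x
  have "cp (P0, Q0)" using P0 Q0 by (simp add: cp_def)
  then obtain x where x: "cp x" "\<And>y. cp y \<Longrightarrow>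
      card (N (fst x) \<inter> N (snd x) \<inter> C) \<le> card (N (fst y) \<inter> N (snd y) \<inter> C)"
    using ex_has_least_nat[of cp "(P0, Q0)" "\<lambda>x. card (N (fst x) \<inter> N (snd x) \<inter> C)"] by auto
  have "card (N (fst x) \<inter> N (snd x) \<inter> C) = 1"
  proof (rule minimal_intersection_singleton[OF C(1)])
    show "card C \<le> card C'" if "cell T' C'" "2 \<le> card C'" for T' C' using that by (rule min)
    show "card (N (fst x) \<inter> N (snd x) \<inter> C) \<le> card (N R' \<inter> N Q' \<inter> C)"
      if "R' \<in> inner T C" "Q' \<in> inner T C" "crosses C R' Q'" for R' Q'
      using x(2)[of "(R', Q')"] that by (simp add: cp_def)
  qed (use x(1) in \<open>auto simp: cp_def\<close>)
  then obtain R Q t where "R \<in> inner T C" "Q \<in> inner T C" "crosses C R Q" "N R \<inter> N Q \<inter> C = {t}"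
    "\<And>W. \<lbrakk>W \<in> inner T C; N W \<inter> (N R \<inter> C - {t}) \<noteq> {}\<rbrakk> \<Longrightarrow> t \<in> N W"
    using end_of_walk[OF C(1)] x(1) unfolding cp_def by metis
  with nr C(1) min show False by (rule singleton_intersection_impossible)
qed

end

section \<open>Induced embeddings\<close>

text \<open>An induced copy of \<open>F\<close> in \<open>G\<close>, given by its vertex map
  alone.\<close>

definition embeds :: "'b pair_pre_digraph \<Rightarrow> 'a pair_pre_digraph \<Rightarrow> ('b \<Rightarrow> 'a) \<Rightarrow> bool" where
  "embeds F G f \<longleftrightarrow> inj_on f (pverts F) \<and> f ` pverts F \<subseteq> pverts G \<and>
     (\<forall>u \<in> pverts F. \<forall>v \<in> pverts F. (u, v) \<in> parcs F \<longleftrightarrow> (f u, f v) \<in> parcs G)"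

lemma wf_with_proj_iff: "wf_digraph (with_proj G) \<longleftrightarrow> parcs G \<subseteq> pverts G \<times> pverts G"
  by (auto simp: wf_digraph_def)

lemma pair_graph_arcsD:
  assumes "pair_graph G"
  shows "finite (pverts G)" "parcs G \<subseteq> pverts G \<times> pverts G" "(v, v) \<notin> parcs G"
    "(u, v) \<in> parcs G \<longleftrightarrow> (v, u) \<in> parcs G"
proof -
  interpret pair_graph G by fact
  show "finite (pverts G)" by (rule pair_finite_verts)
  show "parcs G \<subseteq> pverts G \<times> pverts G" by (auto dest: in_arcsD1 in_arcsD2)
  show "(v, v) \<notin> parcs G" using pair_no_loops by fastforce
  show "(u, v) \<in> parcs G \<longleftrightarrow> (v, u) \<in> parcs G"
    using pair_sym_arcs by (auto simp: symmetric_def elim: symE)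
qed

lemma pair_graphI:
  assumes "finite (pverts G)" "parcs G \<subseteq> pverts G \<times> pverts G" "\<And>v. (v, v) \<notin> parcs G"
    and "\<And>u v. (u, v) \<in> parcs G \<Longrightarrow> (v, u) \<in> parcs G"
  shows "pair_graph G"
proof -
  have "finite (parcs G)" using assms by (meson finite_SigmaI finite_subset)
  then show ?thesis
    using assms by unfold_locales (auto simp: symmetric_def intro!: symI)
qed

text \<open>In a pair graph the tail and head maps are \<open>fst\<close> and \<open>snd\<close>, so
  the vertex map \<open>g\<close> forces the arc map to be \<open>map_prod g g\<close>.\<close>

lemma digraph_iso_with_proj_iff:
  "digraph_iso (with_proj K) (with_proj F) \<longleftrightarrow>
     parcs K \<subseteq> pverts K \<times> pverts K \<and>
     (\<exists>g. inj_on g (pverts K) \<and> pverts F = g ` pverts K \<and> parcs F = map_prod g g ` parcs K)"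
  (is "_ \<longleftrightarrow> ?R")
proof
  assume "digraph_iso (with_proj K) (with_proj F)"
  then obtain h where h: "pre_digraph.digraph_isomorphism (with_proj K) h"
    and F: "with_proj F = app_iso h (with_proj K)" by (auto simp: digraph_iso_def)
  from F have fields: "pverts F = iso_verts h ` pverts K" "parcs F = iso_arcs h ` parcs K"
    "iso_tail h = fst" "iso_head h = snd"
    by (auto simp: with_proj_def app_iso_def)
  have "iso_arcs h a = map_prod (iso_verts h) (iso_verts h) a" if "a \<in> parcs K" for a
    using h that fields by (cases a) (auto simp: pre_digraph.digraph_isomorphism_def prod_eq_iff)
  then show ?R
    using h fields by (auto simp: pre_digraph.digraph_isomorphism_def wf_with_proj_iff image_def
        intro!: exI[of _ "iso_verts h"])
next
  assume ?R
  then obtain g where wf: "parcs K \<subseteq> pverts K \<times> pverts K" and g: "inj_on g (pverts K)"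
    "pverts F = g ` pverts K" "parcs F = map_prod g g ` parcs K" by auto
  let ?h = "\<lparr>iso_verts = g, iso_arcs = map_prod g g, iso_head = snd, iso_tail = fst\<rparr>"
  have "inj_on (map_prod g g) (parcs K)"
    using map_prod_inj_on[OF g(1) g(1)] wf by (rule inj_on_subset)
  then have "pre_digraph.digraph_isomorphism (with_proj K) ?h"
    using wf g by (auto simp: pre_digraph.digraph_isomorphism_def wf_with_proj_iff)
  moreover have "with_proj F = app_iso ?h (with_proj K)"
    using g by (auto simp: with_proj_def app_iso_def)
  ultimately show "digraph_iso (with_proj K) (with_proj F)" by (auto simp: digraph_iso_def)
qed

lemma induced_subgraph_with_proj_iff:
  assumes "pair_graph G"
  shows "induced_subgraph (with_proj K) (with_proj G) \<longleftrightarrow>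
    pverts K \<subseteq> pverts G \<and> parcs K = parcs G \<inter> pverts K \<times> pverts K"
  using pair_graph_arcsD(2)[OF assms]
  by (auto simp: induced_subgraph_def subgraph_def wf_with_proj_iff compatible_def)

text \<open>An induced copy yields an embedding by inverting its isomorphism; conversely, the image
  of an embedding induces a copy.\<close>

lemma H_free_iff:
  assumes "pair_graph G" "pair_graph F"
  shows "H_free F G \<longleftrightarrow> (\<nexists>f. embeds F G f)"
proof -
  have "\<exists>f. embeds F G f"
    if K: "induced_subgraph (with_proj K) (with_proj G)" "digraph_iso (with_proj K) (with_proj F)" for K
  proof -
    from K(2) obtain g where g: "inj_on g (pverts K)" "pverts F = g ` pverts K"
      "parcs F = map_prod g g ` parcs K" and wf: "parcs K \<subseteq> pverts K \<times> pverts K"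
      by (auto simp: digraph_iso_with_proj_iff)
    let ?f = "the_inv_into (pverts K) g"
    have inv: "?f (g x) = x" if "x \<in> pverts K" for x
      using g(1) that by (rule the_inv_into_f_f)
    have arc: "(g x, g y) \<in> parcs F \<longleftrightarrow> (x, y) \<in> parcs G" if "x \<in> pverts K" "y \<in> pverts K" for x y
    proof -
      have "(g x, g y) \<in> parcs F \<longleftrightarrow> (x, y) \<in> parcs K"
        using g(1,3) that wf by (fastforce simp: inj_on_eq_iff)
      then show ?thesis using K(1) that by (auto simp: induced_subgraph_with_proj_iff[OF assms(1)])
    qed
    have "embeds F G ?f"
      unfolding embeds_def g(2)
      using K(1) arc inv by (auto simp: induced_subgraph_with_proj_iff[OF assms(1)] inj_on_def)
    then show ?thesis by blast
  qed
  moreover have "\<not> H_free F G" if f: "embeds F G f" for f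
  proof -
    let ?K = "\<lparr>pverts = f ` pverts F, parcs = parcs G \<inter> (f ` pverts F) \<times> (f ` pverts F)\<rparr>"
    let ?g = "the_inv_into (pverts F) f"
    have inj: "inj_on f (pverts F)" using f by (simp add: embeds_def)
    have inv: "?g (f x) = x" if "x \<in> pverts F" for x
      using inj that by (rule the_inv_into_f_f)
    have "parcs F = map_prod ?g ?g ` parcs ?K"
    proof (intro equalityI subsetI)
      fix e assume e: "e \<in> parcs F"
      obtain u v where uv: "e = (u, v)" by fastforce
      with e pair_graph_arcsD(2)[OF assms(2)] have "u \<in> pverts F" "v \<in> pverts F" by auto
      then show "e \<in> map_prod ?g ?g ` parcs ?K"
        using e uv f inv by (auto simp: embeds_def intro!: image_eqI[of _ _ "(f u, f v)"])
    next
      fix e assume "e \<in> map_prod ?g ?g ` parcs ?K"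
      then show "e \<in> parcs F" using f inv by (auto simp: embeds_def)
    qed
    moreover have "pverts F = ?g ` pverts ?K" using inv by (auto simp: image_iff)
    moreover have "inj_on ?g (pverts ?K)" using inj by (simp add: inj_on_the_inv_into)
    ultimately have "digraph_iso (with_proj ?K) (with_proj F)"
      unfolding digraph_iso_with_proj_iff by auto
    moreover have "induced_subgraph (with_proj ?K) (with_proj G)"
      using f by (auto simp: induced_subgraph_with_proj_iff[OF assms(1)] embeds_def)
    ultimately show ?thesis unfolding H_free_def by blast
  qed
  ultimately show ?thesis unfolding H_free_def by blast
qed

lemma embeds_trans: "embeds F G f \<Longrightarrow> embeds G H g \<Longrightarrow> embeds F H (g \<circ> f)"
  unfolding embeds_def by (auto intro!: comp_inj_on intro: inj_on_subset simp: image_subset_iff)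

lemma H_free_embeds:
  assumes "embeds K G f" "pair_graph K" "pair_graph G" "pair_graph F" "H_free F G"
  shows "H_free F K"
  using assms embeds_trans[OF _ assms(1)] by (auto simp: H_free_iff)

lemma chordal_bipartite_embeds:
  assumes "embeds K G f" "pair_graph K" "chordal_bipartite G"
  shows "chordal_bipartite K"
proof -
  have G: "pair_graph G" "bipartite G" using assms by (auto simp: chordal_bipartite_def)
  then obtain A B where AB: "A \<union> B = pverts G" "A \<inter> B = {}" "parcs G \<subseteq> A \<times> B \<union> B \<times> A"
    by (auto simp: bipartite_def)
  have "parcs K \<subseteq> {v \<in> pverts K. f v \<in> A} \<times> {v \<in> pverts K. f v \<in> B} \<union>
      {v \<in> pverts K. f v \<in> B} \<times> {v \<in> pverts K. f v \<in> A}"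
  proof
    fix e assume e: "e \<in> parcs K"
    then obtain u v where uv: "e = (u, v)" "u \<in> pverts K" "v \<in> pverts K"
      using pair_graph_arcsD(2)[OF assms(2)] by blast
    then have "(f u, f v) \<in> parcs G" using e assms(1) by (auto simp: embeds_def)
    then show "e \<in> {v \<in> pverts K. f v \<in> A} \<times> {v \<in> pverts K. f v \<in> B} \<union>
      {v \<in> pverts K. f v \<in> B} \<times> {v \<in> pverts K. f v \<in> A}"
      using AB uv by auto
  qed
  moreover have "{v \<in> pverts K. f v \<in> A} \<union> {v \<in> pverts K. f v \<in> B} = pverts K"
    using assms(1) AB(1) by (auto simp: embeds_def)
  moreover have "{v \<in> pverts K. f v \<in> A} \<inter> {v \<in> pverts K. f v \<in> B} = {}" using AB(2) by auto
  ultimately have "bipartite K" unfolding bipartite_def by blast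
  moreover have "H_free (cycle_graph k) K" if "6 \<le> k" for k
    using H_free_embeds[OF assms(1,2) G(1) pair_graph_cycle_graph] that assms(3)
    by (simp add: chordal_bipartite_def)
  ultimately show ?thesis using assms(2) by (simp add: chordal_bipartite_def)
qed

abbreviation Zfree_chordal_bipartite :: "nat pair_pre_digraph set" where
  "Zfree_chordal_bipartite \<equiv> {G. chordal_bipartite G \<and> H_free Z_graph G}"

lemma Zfree_chordal_bipartite_embeds:
  assumes "G \<in> Zfree_chordal_bipartite" "pair_graph K" "embeds K G f"
  shows "K \<in> Zfree_chordal_bipartite"
  using assms chordal_bipartite_embeds[OF assms(3,2)] H_free_embeds[OF assms(3,2) _ pair_graph_Z_graph]
  by (auto simp: chordal_bipartite_def)

lemma pair_graph_embeds:
  assumes "embeds K G f" "pair_graph G" "parcs K \<subseteq> pverts K \<times> pverts K"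
  shows "pair_graph K"
proof (rule pair_graphI)
  note G = pair_graph_arcsD[OF assms(2)]
  show "finite (pverts K)"
    using assms(1) G(1) finite_imageD finite_subset unfolding embeds_def by metis
  show "(v, v) \<notin> parcs K" for v
    using assms(1,3) G(3) by (auto simp: embeds_def)
  show "(v, u) \<in> parcs K" if "(u, v) \<in> parcs K" for u v
    using that assms(1,3) G(4)[of "f u" "f v"] by (auto simp: embeds_def)
qed fact

lemma embeds_induced:
  assumes "pverts K \<subseteq> pverts G" "parcs K = parcs G \<inter> pverts K \<times> pverts K"
  shows "embeds K G id"
  using assms by (auto simp: embeds_def)

text \<open>Isomorphic copies and induced subgraphs of \<open>G\<close> both embed into
  \<open>G\<close>, so one closure property covers both conditions.\<close>

lemma hereditary_Zfree_chordal_bipartite: "hereditary Zfree_chordal_bipartite"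
proof -
  let ?X = Zfree_chordal_bipartite
  have pg: "pair_graph G" if "G \<in> ?X" for G using that by (simp add: chordal_bipartite_def)
  have "K \<in> ?X" if G: "G \<in> ?X" and iso: "digraph_iso (with_proj G) (with_proj K)" for G K
  proof -
    obtain g where g: "inj_on g (pverts G)" "pverts K = g ` pverts G" "parcs K = map_prod g g ` parcs G"
      using iso by (auto simp: digraph_iso_with_proj_iff)
    note wf = pair_graph_arcsD(2)[OF pg[OF G]]
    have inv: "the_inv_into (pverts G) g (g x) = x" if "x \<in> pverts G" for x
      using g(1) that by (rule the_inv_into_f_f)
    have "(g x, g y) \<in> parcs K \<longleftrightarrow> (x, y) \<in> parcs G" if "x \<in> pverts G" "y \<in> pverts G" for x y
      using g(1,3) that wf by (fastforce simp: inj_on_eq_iff)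
    then have emb: "embeds K G (the_inv_into (pverts G) g)"
      unfolding embeds_def g(2) using inv by (auto simp: inj_on_def)
    moreover have "pair_graph K"
      using pair_graph_embeds[OF emb pg[OF G]] wf g by auto
    ultimately show ?thesis using Zfree_chordal_bipartite_embeds G by blast
  qed
  moreover have "K \<in> ?X" if G: "G \<in> ?X" and K: "induced_subgraph (with_proj K) (with_proj G)" for G K
  proof -
    have emb: "embeds K G id"
      using K by (intro embeds_induced) (auto simp: induced_subgraph_with_proj_iff[OF pg[OF G]])
    moreover have "pair_graph K"
      using pair_graph_embeds[OF emb pg[OF G]] K
      by (auto simp: induced_subgraph_with_proj_iff[OF pg[OF G]])
    ultimately show ?thesis using Zfree_chordal_bipartite_embeds G by blast
  qed
  ultimately show ?thesis unfolding hereditary_def graph_class_def using pg by blast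
qed

section \<open>From graphs to hypergraphs\<close>

definition nbrs :: "'a pair_pre_digraph \<Rightarrow> 'a \<Rightarrow> 'a set" where
  "nbrs G v = {u. (v, u) \<in> parcs G}"

lemma cycle_graph_arc_iff:
  "(u, v) \<in> parcs (cycle_graph k) \<longleftrightarrow> u < k \<and> v < k \<and> (v = Suc u mod k \<or> u = Suc v mod k)"
  by (auto simp: cycle_graph_def graph_of_edges_def symcl_def)

lemma tame_hypergraph_nbrs:
  assumes "chordal_bipartite G" "H_free Z_graph G"
    and AB: "A \<union> B = pverts G" "A \<inter> B = {}" "parcs G \<subseteq> A \<times> B \<union> B \<times> A"
  shows "tame_hypergraph A B (nbrs G)"
proof
  have G: "pair_graph G" using assms(1) by (simp add: chordal_bipartite_def)
  note GD = pair_graph_arcsD[OF G]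
  show "finite A" "finite B" using GD(1) AB(1) by (metis finite_Un)+
  show "nbrs G r \<subseteq> B" if "r \<in> A" for r using that AB by (auto simp: nbrs_def)
  have AA: "(u, v) \<notin> parcs G" if "u \<in> A" "v \<in> A" for u v using that AB by blast
  have BB: "(u, v) \<notin> parcs G" if "u \<in> B" "v \<in> B" for u v using that AB by blast
  show False
    if m: "3 \<le> m" and r: "\<And>j. j < m \<Longrightarrow> r j \<in> A"
      and c: "\<And>i j. \<lbrakk>i < m; j < m\<rbrakk> \<Longrightarrow> c i \<in> nbrs G (r j) \<longleftrightarrow> j = i \<or> j = Suc i mod m"
    for m and r c :: "nat \<Rightarrow> 'a"
  proof -
    have arc: "(r j, c i) \<in> parcs G \<longleftrightarrow> j = i \<or> j = Suc i mod m" if "i < m" "j < m" for i j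
      using c[OF that] by (simp add: nbrs_def)
    have cB: "c i \<in> B" if "i < m" for i
    proof -
      have "(r i, c i) \<in> parcs G" using arc that by simp
      then show ?thesis using r[OF that] AB by blast
    qed
    \<comment> \<open>As \<open>m \<ge> 3\<close>, two steps around the cycle never return to the
      start. This makes \<open>r\<close> and \<open>c\<close> injective.\<close>
    have wrap: "Suc (Suc i mod m) mod m \<noteq> i" if "i < m" for i
      using m that by (auto simp: mod_Suc)
    have inj_r: "inj_on r {..<m}"
    proof (rule inj_onI)
      fix i j assume ij: "i \<in> {..<m}" "j \<in> {..<m}" "r i = r j"
      then have "j = i \<or> j = Suc i mod m" "i = j \<or> i = Suc j mod m"
        using arc[of i i] arc[of i j] arc[of j j] arc[of j i] by auto
      then show "i = j" using wrap[of i] ij(1) by auto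
    qed
    have inj_c: "inj_on c {..<m}"
    proof (rule inj_onI)
      fix i j assume ij: "i \<in> {..<m}" "j \<in> {..<m}" "c i = c j"
      then have "i = j \<or> i = Suc j mod m" "j = i \<or> j = Suc i mod m"
        using arc[of i i] arc[of j i] arc[of j j] arc[of i j] by auto
      then show "i = j" using wrap[of i] ij(1) by auto
    qed
    \<comment> \<open>Rows take the even and columns the odd positions; \<open>c j\<close> lies
      between \<open>r j\<close> and \<open>r (Suc j mod m)\<close>.\<close>
    define f where "f v = (if even v then r (v div 2) else c (v div 2))" for v :: nat
    have f_even: "f (2 * j) = r j" and f_odd: "f (Suc (2 * j)) = c j" for j
      by (auto simp: f_def)
    have parity: "(\<exists>j < m. v = 2 * j) \<or> (\<exists>j < m. v = Suc (2 * j))" if "v < 2 * m" for v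
      using that by (cases "even v") (auto elim!: evenE oddE)
    have rc: "r i \<noteq> c j" if "i < m" "j < m" for i j using r[OF that(1)] cB[OF that(2)] AB(2) by auto
    have suc_odd: "Suc (Suc (2 * i)) mod (2 * m) = 2 * (Suc i mod m)" for i
      using mod_mult_mult1[of 2 "Suc i" m] by simp
    have suc_even: "Suc (2 * i) mod (2 * m) = Suc (2 * i)" if "i < m" for i using that by simp
    have even_odd: "2 * i \<noteq> Suc (2 * j)" for i j :: nat by presburger
    have "embeds (cycle_graph (2 * m)) G f"
      unfolding embeds_def
    proof (intro conjI ballI)
      have V: "pverts (cycle_graph (2 * m)) = {..<2 * m}"
        by (auto simp: cycle_graph_def graph_of_edges_def)
      show "inj_on f (pverts (cycle_graph (2 * m)))"
        unfolding V
      proof (rule inj_onI)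
        fix u v assume uv: "u \<in> {..<2 * m}" "v \<in> {..<2 * m}" "f u = f v"
        then show "u = v"
          using parity[of u] parity[of v] inj_r inj_c rc rc[symmetric]
          by (auto simp: f_even f_odd inj_on_eq_iff)
      qed
      show "f ` pverts (cycle_graph (2 * m)) \<subseteq> pverts G"
        unfolding V using parity r cB AB(1) by (fastforce simp: f_even f_odd)
      fix u v assume "u \<in> pverts (cycle_graph (2 * m))" "v \<in> pverts (cycle_graph (2 * m))"
      then have uv: "u < 2 * m" "v < 2 * m" by (auto simp: V)
      consider i j where "i < m" "j < m" "u = 2 * i" "v = 2 * j"
        | i j where "i < m" "j < m" "u = 2 * i" "v = Suc (2 * j)"
        | i j where "i < m" "j < m" "u = Suc (2 * i)" "v = 2 * j"
        | i j where "i < m" "j < m" "u = Suc (2 * i)" "v = Suc (2 * j)"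
        using parity[OF uv(1)] parity[OF uv(2)] by blast
      then show "(u, v) \<in> parcs (cycle_graph (2 * m)) \<longleftrightarrow> (f u, f v) \<in> parcs G"
      proof cases
        case 1
        then show ?thesis using AA r
          by (simp add: cycle_graph_arc_iff f_even suc_even even_odd)
      next
        case 2
        then show ?thesis using arc
          by (auto simp: cycle_graph_arc_iff f_even f_odd suc_even suc_odd)
      next
        case 3
        then show ?thesis using arc GD(4)
          by (auto simp: cycle_graph_arc_iff f_even f_odd suc_even suc_odd)
      next
        case 4
        then show ?thesis using BB cB even_odd[symmetric]
          by (simp add: cycle_graph_arc_iff f_odd suc_odd)
      qed
    qed
    moreover have "H_free (cycle_graph (2 * m)) G" "pair_graph (cycle_graph (2 * m))"
      using assms(1) m by (auto simp: chordal_bipartite_def intro: pair_graph_cycle_graph)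
    ultimately show False using G by (auto simp: H_free_iff)
  qed
  show False
    if "c1 \<in> A" "c3 \<in> A" "q \<in> A" "x \<noteq> y" "x \<in> nbrs G c1 \<inter> nbrs G c3 - nbrs G q"
      "y \<in> nbrs G c1 \<inter> nbrs G c3 - nbrs G q"
      "p \<in> nbrs G c1 \<inter> nbrs G q - nbrs G c3" "u \<in> nbrs G q - nbrs G c1 - nbrs G c3"
    for c1 c3 q x y p u
  proof -
    have arcs: "(c1, x) \<in> parcs G" "(c3, x) \<in> parcs G" "(q, x) \<notin> parcs G"
      "(c1, y) \<in> parcs G" "(c3, y) \<in> parcs G" "(q, y) \<notin> parcs G"
      "(c1, p) \<in> parcs G" "(c3, p) \<notin> parcs G" "(q, p) \<in> parcs G"
      "(c1, u) \<notin> parcs G" "(c3, u) \<notin> parcs G" "(q, u) \<in> parcs G"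
      using that by (auto simp: nbrs_def)
    then have inB: "x \<in> B" "y \<in> B" "p \<in> B" "u \<in> B" using that(1-3) AB by blast+
    have sym: "(v, w) \<in> parcs G \<longleftrightarrow> (w, v) \<in> parcs G" for v w by (rule GD(4))
    have rev: "(x, c1) \<in> parcs G" "(x, c3) \<in> parcs G" "(x, q) \<notin> parcs G"
      "(y, c1) \<in> parcs G" "(y, c3) \<in> parcs G" "(y, q) \<notin> parcs G"
      "(p, c1) \<in> parcs G" "(p, c3) \<notin> parcs G" "(p, q) \<in> parcs G"
      "(u, c1) \<notin> parcs G" "(u, c3) \<notin> parcs G" "(u, q) \<in> parcs G"
      using arcs sym by blast+
    have cross: "a \<noteq> b" if "a \<in> A" "b \<in> B" for a b using that AB(2) by auto
    have dist: "distinct [c1, x, c3, y, p, q, u]"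
      using that(1-4) inB cross cross[symmetric] arcs by auto
    have V: "pverts Z_graph = {1, 2, 3, 4, 5, 6, 7}"
      by (auto simp: Z_graph_def graph_of_edges_def)
    \<comment> \<open>The list follows the numbering c1, c2, c3, c4, p, q, r, which starts at
      1.\<close>
    define f where "f i = [c1, x, c3, y, p, q, u] ! (i - 1)" for i :: nat
    have f: "f 1 = c1" "f (Suc 0) = c1" "f 2 = x" "f 3 = c3" "f 4 = y" "f 5 = p" "f 6 = q" "f 7 = u"
      by (simp_all add: f_def)
    have "embeds Z_graph G f"
      unfolding embeds_def V
    proof (intro conjI)
      show "inj_on f {1, 2, 3, 4, 5, 6, 7}"
        using dist by (auto simp: inj_on_def f)
      show "f ` {1, 2, 3, 4, 5, 6, 7} \<subseteq> pverts G"
        using that(1-3) inB AB(1) by (auto simp: f)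
      show "\<forall>v \<in> {1, 2, 3, 4, 5, 6, 7}. \<forall>w \<in> {1, 2, 3, 4, 5, 6, 7}.
          (v, w) \<in> parcs Z_graph \<longleftrightarrow> (f v, f w) \<in> parcs G"
        using arcs rev AA BB that(1-3) inB GD(3)
        by (simp add: f Z_graph_def graph_of_edges_def symcl_def)
    qed
    then show False using assms(2) G pair_graph_Z_graph by (auto simp: H_free_iff)
  qed
qed

text \<open>Rows and columns are treated alike here, with \<open>a = b = d\<close> for a column.
  \<open>S\<close> avoids \<open>v\<close> because it lies on the other side of the bipartition;
  hence it is still visible after \<open>v\<close> is removed.\<close>

lemma ex_describable_vertex:
  assumes "G \<in> Zfree_chordal_bipartite" "pverts G \<noteq> {}"
  shows "\<exists>v \<in> pverts G. \<exists>S. v \<notin> S \<and>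
    (S = {} \<or> (\<exists>a \<in> pverts G - {v}. \<exists>b \<in> pverts G - {v}. S = nbrs G a \<inter> nbrs G b)) \<and>
    card ((nbrs G v - S) \<union> (S - nbrs G v)) \<le> 4"
proof -
  have G: "chordal_bipartite G" "H_free Z_graph G" using assms by auto
  then obtain A B where AB: "A \<union> B = pverts G" "A \<inter> B = {}" "parcs G \<subseteq> A \<times> B \<union> B \<times> A"
    by (auto simp: chordal_bipartite_def bipartite_def)
  interpret tame_hypergraph A B "nbrs G" using G AB by (rule tame_hypergraph_nbrs)
  have sym: "u \<in> nbrs G v \<longleftrightarrow> v \<in> nbrs G u" for u v
    unfolding nbrs_def mem_Collect_eq
    by (rule pair_graph_arcsD(4)) (use G(1) in \<open>simp add: chordal_bipartite_def\<close>)
  have "A \<noteq> {} \<or> B \<noteq> {}" using AB(1) assms(2) by auto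
  then show ?thesis
  proof (rule disjE[OF ex_describable])
    assume "\<exists>P \<in> A. row_describable P"
    then obtain P S where P: "P \<in> A"
      and S: "S = {} \<or> (\<exists>a \<in> A - {P}. \<exists>b \<in> A - {P}. S = nbrs G a \<inter> nbrs G b)"
      and c: "card ((nbrs G P - S) \<union> (S - nbrs G P)) \<le> 4"
      unfolding row_describable_def by blast
    have "S = {} \<or> S \<subseteq> B" using S N_subset by blast
    then have "P \<notin> S" using P AB(2) by auto
    then show ?thesis using P S c AB(1) by blast
  next
    assume "\<exists>c \<in> B. column_describable c"
    then obtain c where c: "c \<in> B" "column_describable c" by blast
    have nb: "nbrs G d = {r \<in> A. d \<in> nbrs G r}" if "d \<in> B" for d
    proof -
      have "nbrs G d \<subseteq> A" using that AB by (auto simp: nbrs_def)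
      then show ?thesis using sym by blast
    qed
    show ?thesis
    proof (cases "card {r \<in> A. c \<in> nbrs G r} \<le> 4")
      case True
      then show ?thesis using nb[OF c(1)] c(1) AB(1) by (intro bexI[of _ c] exI[of _ "{}"]) auto
    next
      case False
      then obtain d where d: "d \<in> B - {c}" "card {r \<in> A. c \<in> nbrs G r \<longleftrightarrow> d \<notin> nbrs G r} \<le> 4"
        using c(2) unfolding column_describable_def by blast
      have "(nbrs G c - nbrs G d) \<union> (nbrs G d - nbrs G c) = {r \<in> A. c \<in> nbrs G r \<longleftrightarrow> d \<notin> nbrs G r}"
        using nb[of c] nb[of d] c d by blast
      moreover have "c \<notin> nbrs G d" using nb[of d] c d AB(2) by blast
      ultimately show ?thesis
        using c d AB(1) by (intro bexI[of _ c] exI[of _ "nbrs G d"]) auto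
    qed
  qed
qed

section \<open>Counting\<close>

text \<open>The vertex set is arbitrary because vertices are removed one by one while the labels
  stay within \<open>{1..n}\<close>.\<close>

definition graphs_on :: "nat set \<Rightarrow> nat pair_pre_digraph set" where
  "graphs_on V = {G \<in> Zfree_chordal_bipartite. pverts G = V}"

lemma labelled_graphs_eq: "labelled_graphs Zfree_chordal_bipartite n = graphs_on {1..n}"
  by (simp add: labelled_graphs_def graphs_on_def)

lemma pair_graph_graphs_on: "G \<in> graphs_on V \<Longrightarrow> pair_graph G"
  by (auto simp: graphs_on_def chordal_bipartite_def)

lemma finite_graphs_on:
  assumes "finite V"
  shows "finite (graphs_on V)"
proof (rule finite_subset)
  show "graphs_on V \<subseteq> (\<lambda>E. \<lparr>pverts = V, parcs = E\<rparr>) ` Pow (V \<times> V)"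
  proof
    fix G assume G: "G \<in> graphs_on V"
    then have "G = \<lparr>pverts = V, parcs = parcs G\<rparr>" by (auto simp: graphs_on_def)
    moreover have "parcs G \<in> Pow (V \<times> V)"
      using pair_graph_arcsD(2)[OF pair_graph_graphs_on[OF G]] G by (auto simp: graphs_on_def)
    ultimately show "G \<in> (\<lambda>E. \<lparr>pverts = V, parcs = E\<rparr>) ` Pow (V \<times> V)" by blast
  qed
qed (use assms in simp)

text \<open>The list \<open>a # b # es\<close> codes the neighbourhood
  \<open>nbrs G a \<inter> nbrs G b \<triangle> set es\<close>. The label \<open>0\<close>, which is never a vertex, has no neighbours,
  so \<open>a = b = 0\<close> codes an empty intersection; as an element of \<open>es\<close> it is padding.\<close>

definition attach :: "nat \<Rightarrow> nat list \<times> nat pair_pre_digraph \<Rightarrow> nat pair_pre_digraph" where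
  "attach v = (\<lambda>(xs, G).
     let S = nbrs G (xs ! 0) \<inter> nbrs G (xs ! 1); E = set (drop 2 xs);
       X = pverts G \<inter> ((S - E) \<union> (E - S))
     in \<lparr>pverts = insert v (pverts G), parcs = parcs G \<union> {v} \<times> X \<union> X \<times> {v}\<rparr>)"

lemma graphs_on_subset_attach:
  assumes V: "V \<subseteq> {1..n}" "V \<noteq> {}"
  shows "graphs_on V \<subseteq> (\<Union>v \<in> V. attach v `
    ({xs. set xs \<subseteq> {0..n} \<and> length xs = 6} \<times> graphs_on (V - {v})))"
proof
  fix G assume G: "G \<in> graphs_on V"
  then have GV: "pverts G = V" and GZ: "G \<in> Zfree_chordal_bipartite" by (auto simp: graphs_on_def)
  note pg = pair_graph_graphs_on[OF G]
  note GD = pair_graph_arcsD[OF pg]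
  obtain v S where v: "v \<in> V" and vS: "v \<notin> S"
    and S: "S = {} \<or> (\<exists>a \<in> V - {v}. \<exists>b \<in> V - {v}. S = nbrs G a \<inter> nbrs G b)"
    and c: "card ((nbrs G v - S) \<union> (S - nbrs G v)) \<le> 4"
    using ex_describable_vertex[OF GZ, unfolded GV, OF V(2)] by (elim bexE exE conjE) (rule that)
  define K where "K = \<lparr>pverts = V - {v}, parcs = parcs G \<inter> (V - {v}) \<times> (V - {v})\<rparr>"
  have emb: "embeds K G id" by (rule embeds_induced) (auto simp: K_def GV)
  have pK: "pair_graph K" by (rule pair_graph_embeds[OF emb pg]) (simp add: K_def)
  have K: "K \<in> graphs_on (V - {v})"
    using Zfree_chordal_bipartite_embeds[OF GZ pK emb] by (simp add: graphs_on_def K_def)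
  have nbV: "nbrs G u \<subseteq> V" for u using GD(2) by (auto simp: nbrs_def GV)
  \<comment> \<open>Label 0 and \<open>v\<close> have no neighbours in \<open>K\<close>. For other
    vertices only \<open>v\<close> is lost, so intersections avoiding \<open>v\<close> are
    unchanged.\<close>
  have nbK: "nbrs K u = (if u \<in> V - {v} then nbrs G u - {v} else {})" for u
    using GD(2) by (auto simp: nbrs_def K_def GV)
  have zero: "0 \<notin> V" using V by auto
  obtain a b where ab: "a \<in> {0..n}" "b \<in> {0..n}" "S = nbrs K a \<inter> nbrs K b"
  proof (cases "S = {}")
    case True
    then show thesis using that[of 0 0] zero nbK by auto
  next
    case False
    then obtain a b where *: "a \<in> V - {v}" "b \<in> V - {v}" "S = nbrs G a \<inter> nbrs G b" using S by auto
    show thesis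
    proof (rule that)
      show "a \<in> {0..n}" "b \<in> {0..n}" using *(1,2) V(1) by auto
      show "S = nbrs K a \<inter> nbrs K b" using * vS by (auto simp: nbK)
    qed
  qed
  define D where "D = (nbrs G v - S) \<union> (S - nbrs G v)"
  have vv: "v \<notin> nbrs G v" using GD(3) by (simp add: nbrs_def)
  have SV: "S \<subseteq> V" using ab(3) nbK nbV by (auto split: if_splits)
  have DV: "D \<subseteq> V - {v}" using nbV SV vS vv by (auto simp: D_def)
  have finD: "finite D" using DV V(1) finite_subset by (metis Diff_subset finite_atLeastAtMost)
  \<comment> \<open>Padding with 0 brings the list to length 4 without adding a vertex.\<close>
  define es where "es = sorted_list_of_set D @ replicate (4 - card D) 0"
  have es: "length es = 4" "set es \<subseteq> {0..n}" "set es \<inter> V = D"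
    using c finD DV V zero by (auto simp: es_def D_def[symmetric])
  have "attach v (a # b # es, K) = G"
  proof -
    have "(V - {v}) \<inter> ((S - set es) \<union> (set es - S)) = nbrs G v"
    proof -
      have "(V - {v}) \<inter> ((S - set es) \<union> (set es - S)) = (S - D) \<union> (D - S)"
        using es(3) SV vS DV by blast
      then show ?thesis by (auto simp: D_def)
    qed
    moreover have "parcs K \<union> {v} \<times> nbrs G v \<union> nbrs G v \<times> {v} = parcs G"
      using GD(2) GD(4) by (auto simp: K_def nbrs_def GV)
    ultimately show ?thesis
      using ab(3) v GV by (simp add: attach_def Let_def K_def insert_absorb)
  qed
  then have "G \<in> attach v ` ({xs. set xs \<subseteq> {0..n} \<and> length xs = 6} \<times> graphs_on (V - {v}))"
    using ab(1,2) es K by (intro image_eqI[of _ _ "(a # b # es, K)"]) auto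
  then show "G \<in> (\<Union>v \<in> V. attach v ` ({xs. set xs \<subseteq> {0..n} \<and> length xs = 6} \<times> graphs_on (V - {v})))"
    using v by blast
qed

text \<open>Each vertex removed costs a factor \<open>(n + 1) ^ 6\<close> for the labels and at most
  \<open>n + 1\<close> for its own choice; \<open>n\<close> stays fixed while \<open>V\<close>
  shrinks.\<close>

lemma card_graphs_on_le:
  assumes "V \<subseteq> {1..n}"
  shows "card (graphs_on V) \<le> ((n + 1) ^ 7) ^ card V"
  using assms
proof (induction "card V" arbitrary: V)
  case 0
  then have "V = {}" using finite_subset by fastforce
  have "graphs_on {} \<subseteq> {\<lparr>pverts = {}, parcs = {}\<rparr>}"
    using pair_graph_arcsD(2)[OF pair_graph_graphs_on] by (fastforce simp: graphs_on_def)
  from card_mono[OF _ this] have "card (graphs_on V) \<le> 1" using \<open>V = {}\<close> by simp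
  then show ?case using \<open>V = {}\<close> by simp
next
  case (Suc k)
  let ?L = "{xs :: nat list. set xs \<subseteq> {0..n} \<and> length xs = 6}"
  have finV: "finite V" using Suc.prems finite_subset by blast
  have cL: "card ?L = (n + 1) ^ 6" "finite ?L"
    by (simp_all add: card_lists_length_eq finite_lists_length_eq)
  have "V \<noteq> {}" using Suc.hyps(2) by auto
  then have "card (graphs_on V) \<le> card (\<Union>v \<in> V. attach v ` (?L \<times> graphs_on (V - {v})))"
    using graphs_on_subset_attach[OF Suc.prems] finV cL(2) finite_graphs_on
    by (intro card_mono) auto
  also have "\<dots> \<le> (\<Sum>v \<in> V. card (attach v ` (?L \<times> graphs_on (V - {v}))))"
    using finV by (rule card_UN_le)
  also have "\<dots> \<le> (\<Sum>v \<in> V. (n + 1) ^ 6 * ((n + 1) ^ 7) ^ k)"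
  proof (rule sum_mono)
    fix v assume v: "v \<in> V"
    have "card (attach v ` (?L \<times> graphs_on (V - {v}))) \<le> card (?L \<times> graphs_on (V - {v}))"
      using finV cL(2) finite_graphs_on by (intro card_image_le) auto
    also have "\<dots> = (n + 1) ^ 6 * card (graphs_on (V - {v}))" by (simp add: card_cartesian_product cL)
    also have "\<dots> \<le> (n + 1) ^ 6 * ((n + 1) ^ 7) ^ k"
    proof -
      have "k = card (V - {v})" using v Suc.hyps(2) finV by simp
      moreover have "V - {v} \<subseteq> {1..n}" using Suc.prems by auto
      ultimately show ?thesis using Suc.hyps(1)[of "V - {v}"] by simp
    qed
    finally show "card (attach v ` (?L \<times> graphs_on (V - {v}))) \<le> (n + 1) ^ 6 * ((n + 1) ^ 7) ^ k" .
  qed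
  also have "\<dots> = card V * ((n + 1) ^ 6 * ((n + 1) ^ 7) ^ k)" by simp
  also have "\<dots> \<le> (n + 1) * ((n + 1) ^ 6 * ((n + 1) ^ 7) ^ k)"
    using card_mono[OF _ Suc.prems] by (intro mult_right_mono) auto
  also have "\<dots> = ((n + 1) ^ 7) ^ card V"
  proof -
    have "(n + 1) ^ 7 = (n + 1) * (n + 1) ^ 6" by (simp only: power_Suc[symmetric]) simp
    then show ?thesis by (simp only: Suc.hyps(2)[symmetric] power_Suc mult.assoc)
  qed
  finally show ?case .
qed

section \<open>Lower bound from star forests\<close>

definition star_forest :: "nat \<Rightarrow> nat \<Rightarrow> (nat \<Rightarrow> nat) \<Rightarrow> nat pair_pre_digraph" where
  "star_forest n m \<phi> = graph_of_edges {1..n} {(i, \<phi> i) | i. i \<in> {m+1..n}}"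

lemma star_forest_arc_iff:
  "(u, v) \<in> parcs (star_forest n m \<phi>) \<longleftrightarrow> u \<in> {m+1..n} \<and> v = \<phi> u \<or> v \<in> {m+1..n} \<and> u = \<phi> v"
  by (auto simp: star_forest_def graph_of_edges_def symcl_def)

lemma star_forest_in_graphs_on:
  assumes phi: "\<phi> \<in> {m+1..n} \<rightarrow> {1..m}" and "m \<le> n"
  shows "star_forest n m \<phi> \<in> graphs_on {1..n}"
proof -
  let ?G = "star_forest n m \<phi>"
  have phiD: "1 \<le> \<phi> i \<and> \<phi> i \<le> m" if "i \<in> {m+1..n}" for i using phi that by auto
  have V: "pverts ?G = {1..n}" by (simp add: star_forest_def graph_of_edges_def)
  have pg: "pair_graph ?G"
    unfolding star_forest_def
    by (rule pair_graph_graph_of_edges) (use phiD \<open>m \<le> n\<close> in fastforce)+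
  \<comment> \<open>One of the adjacent vertices \<open>b\<close> and \<open>c\<close> is a leaf,
    with label above \<open>m\<close>, and a leaf has its centre as only neighbour. Long cycles and
    Z both contain such a walk.\<close>
  have no_path: False
    if "(a, b) \<in> parcs ?G" "(b, c) \<in> parcs ?G" "(c, d) \<in> parcs ?G" "a \<noteq> c" "b \<noteq> d" for a b c d
    using that phiD[of a] phiD[of b] phiD[of c] phiD[of d] unfolding star_forest_arc_iff by auto
  have no_embed: "H_free F ?G"
    if F: "pair_graph F" "a \<in> pverts F" "b \<in> pverts F" "c \<in> pverts F" "d \<in> pverts F"
      "(a, b) \<in> parcs F" "(b, c) \<in> parcs F" "(c, d) \<in> parcs F" "a \<noteq> c" "b \<noteq> d"
    for F :: "nat pair_pre_digraph" and a b c d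
  proof -
    have False if f: "embeds F ?G f" for f
      using f F no_path[of "f a" "f b" "f c" "f d"] by (auto simp: embeds_def inj_on_eq_iff)
    then show ?thesis using H_free_iff[OF pg F(1)] by blast
  qed
  have "H_free (cycle_graph k) ?G" if "6 \<le> k" for k
    using that by (intro no_embed[of _ 0 1 2 3] pair_graph_cycle_graph)
      (auto simp: cycle_graph_arc_iff, auto simp: cycle_graph_def graph_of_edges_def)
  moreover have "H_free Z_graph ?G"
    by (intro no_embed[of _ 1 2 3 4] pair_graph_Z_graph)
      (auto simp: Z_graph_def graph_of_edges_def symcl_def)
  moreover have "bipartite ?G"
  proof -
    have "{1..m} \<union> {m+1..n} = pverts ?G"
      unfolding V using \<open>m \<le> n\<close> by auto
    moreover have "{1..m} \<inter> {m+1..n} = {}" by simp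
    moreover have "parcs ?G \<subseteq> {1..m} \<times> {m+1..n} \<union> {m+1..n} \<times> {1..m}"
    proof
      fix e assume "e \<in> parcs ?G"
      then obtain i where "i \<in> {m+1..n}" "e = (i, \<phi> i) \<or> e = (\<phi> i, i)"
        by (cases e) (auto simp: star_forest_arc_iff)
      then show "e \<in> {1..m} \<times> {m+1..n} \<union> {m+1..n} \<times> {1..m}" using phi by auto
    qed
    ultimately show ?thesis unfolding bipartite_def by blast
  qed
  ultimately show ?thesis using pg V by (auto simp: graphs_on_def chordal_bipartite_def)
qed

lemma inj_on_star_forest: "inj_on (star_forest n m) ({m+1..n} \<rightarrow>\<^sub>E {1..m})"
proof (rule inj_onI)
  fix \<phi> \<psi> assume *: "\<phi> \<in> {m+1..n} \<rightarrow>\<^sub>E {1..m}" "\<psi> \<in> {m+1..n} \<rightarrow>\<^sub>E {1..m}"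
    "star_forest n m \<phi> = star_forest n m \<psi>"
  show "\<phi> = \<psi>"
  proof (rule PiE_ext[OF *(1,2)])
    fix i assume i: "i \<in> {m+1..n}"
    then have "(i, \<phi> i) \<in> parcs (star_forest n m \<psi>)"
      using *(3) by (simp add: star_forest_arc_iff flip: *(3))
    \<comment> \<open>Thus \<open>\<phi> i\<close> is not a leaf, and the arc can only come from the
      leaf \<open>i\<close>, whose centre is \<open>\<psi> i\<close>.\<close>
    moreover have "\<phi> i \<le> m" using PiE_mem[OF *(1) i] by simp
    ultimately show "\<phi> i = \<psi> i" by (auto simp: star_forest_arc_iff)
  qed
qed

lemma card_graphs_on_ge:
  assumes "m \<le> n"
  shows "m ^ (n - m) \<le> card (graphs_on {1..n})"
proof -
  have "m ^ (n - m) = card ({m+1..n} \<rightarrow>\<^sub>E {1..m})" by (simp add: card_PiE)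
  also have "\<dots> = card (star_forest n m ` ({m+1..n} \<rightarrow>\<^sub>E {1..m}))"
    by (rule card_image[OF inj_on_star_forest, symmetric])
  also have "\<dots> \<le> card (graphs_on {1..n})"
    using star_forest_in_graphs_on[OF _ assms] finite_graphs_on
    by (intro card_mono) (auto simp: PiE_def)
  finally show ?thesis .
qed

section \<open>Logarithms of both bounds\<close>

lemma log_card_upper:
  assumes "2 \<le> n" "0 < card (graphs_on {1..n})"
  shows "log 2 (card (graphs_on {1..n})) \<le> 14 * (n * log 2 n)"
proof -
  have "real (card (graphs_on {1..n})) \<le> real (((n + 1) ^ 7) ^ n)"
    using card_graphs_on_le[of "{1..n}" n] by (simp only: of_nat_le_iff) simp
  also have "\<dots> = real (n + 1) ^ (7 * n)" by (simp add: power_mult)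
  finally have "log 2 (card (graphs_on {1..n})) \<le> log 2 (real (n + 1) ^ (7 * n))"
    using assms by simp
  also have "\<dots> = 7 * n * log 2 (n + 1)" by (simp add: log_nat_power)
  also have "\<dots> \<le> 7 * n * (2 * log 2 n)"
  proof (rule mult_left_mono)
    \<comment> \<open>This costs a factor 2 in the logarithm, which with the exponent
      \<open>7 * n\<close> gives the constant 14.\<close>
    have "n + 1 \<le> n ^ 2"
      using mult_le_mono1[OF assms(1), of n] assms(1) unfolding power2_eq_square by linarith
    then have "real (n + 1) \<le> real (n ^ 2)" by (simp only: of_nat_le_iff)
    then have "log 2 (n + 1) \<le> log 2 (real n ^ 2)" by (intro log_mono) simp_all
    then show "log 2 (n + 1) \<le> 2 * log 2 n" using assms(1) by (simp add: log_nat_power)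
  qed simp
  finally show ?thesis by simp
qed

lemma log_card_lower:
  assumes "6 \<le> n"
  shows "0 < card (graphs_on {1..n})" "1 / 4 * (n * log 2 n) \<le> log 2 (card (graphs_on {1..n}))"
proof -
  \<comment> \<open>With half of the vertices as centres, at least \<open>n / 2\<close> leaves
    remain. For \<open>m \<ge> 3\<close> also \<open>n \<le> m ^ 2\<close>, so
    \<open>log 2 m\<close> is at least half of \<open>log 2 n\<close>; together this gives
    1/4.\<close>
  define m where "m = n div 2"
  have m: "3 \<le> m" "n \<le> 2 * m + 1" "m \<le> n" "n \<le> 2 * (n - m)" using assms by (auto simp: m_def)
  have le: "m ^ (n - m) \<le> card (graphs_on {1..n})" by (rule card_graphs_on_ge) fact
  moreover have "0 < m ^ (n - m)" using m by simp
  ultimately show pos: "0 < card (graphs_on {1..n})" by (rule order.strict_trans2[rotated])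
  have "n \<le> m ^ 2" using m mult_le_mono1[OF m(1), of m] unfolding power2_eq_square by linarith
  then have "real n \<le> real (m ^ 2)" by (simp only: of_nat_le_iff)
  then have "log 2 n \<le> log 2 (real (m ^ 2))" using assms by (intro log_mono) simp_all
  also have "\<dots> = 2 * log 2 m" using m by (simp add: log_nat_power)
  finally have 1: "log 2 n / 2 \<le> log 2 m" by simp
  have "1 / 4 * (n * log 2 n) = (n / 2) * (log 2 n / 2)" by simp
  also have "\<dots> \<le> real (n - m) * log 2 m"
    using m(4) 1 assms by (intro mult_mono) auto
  also have "\<dots> = log 2 (real m ^ (n - m))" using m by (simp add: log_nat_power)
  also have "\<dots> \<le> log 2 (card (graphs_on {1..n}))"
  proof (rule log_mono)
    show "real m ^ (n - m) \<le> card (graphs_on {1..n})"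
      using le by (metis of_nat_le_iff of_nat_power)
  qed (use m in simp_all)
  finally show "1 / 4 * (n * log 2 n) \<le> log 2 (card (graphs_on {1..n}))" .
qed

theorem theorem21:
  shows "factorial_class {G. chordal_bipartite G \<and> H_free Z_graph G}"
proof -
  \<comment> \<open>Taking the exact logarithm makes the count equal to \<open>2 powr f n\<close> as
    soon as it is positive, which is shown for \<open>n \<ge> 6\<close>.\<close>
  define f where "f n = log 2 (card (graphs_on {1..n}))" for n
  have "f \<in> \<Theta>(\<lambda>n. real n * log 2 (real n))"
  proof (rule bigthetaI)
    show "f \<in> O(\<lambda>n. real n * log 2 (real n))"
    proof (rule bigoI[of _ 14])
      show "\<forall>\<^sub>F n in at_top. norm (f n) \<le> 14 * norm (real n * log 2 (real n))"
        using eventually_ge_at_top[of 6]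
      proof eventually_elim
        case (elim n)
        then have "0 \<le> f n" using log_card_lower(1)[of n] by (simp add: f_def)
        then show ?case using log_card_upper[of n] log_card_lower(1)[of n] elim by (simp add: f_def)
      qed
    qed
    show "f \<in> \<Omega>(\<lambda>n. real n * log 2 (real n))"
    proof (rule landau_omega.bigI[of "1 / 4"])
      show "\<forall>\<^sub>F n in at_top. 1 / 4 * norm (real n * log 2 (real n)) \<le> norm (f n)"
        using eventually_ge_at_top[of 6]
      proof eventually_elim
        case (elim n)
        then show ?case using log_card_lower[of n] by (simp add: f_def)
      qed
    qed simp
  qed
  moreover have "\<forall>\<^sub>F n in at_top. real (card (labelled_graphs Zfree_chordal_bipartite n)) = 2 powr f n"
    using eventually_ge_at_top[of 6]
  proof eventually_elim
    case (elim n)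
    then show ?case using log_card_lower(1)[of n] by (simp add: f_def labelled_graphs_eq)
  qed
  ultimately show ?thesis
    unfolding factorial_class_def using hereditary_Zfree_chordal_bipartite by blast
qed

end
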